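(* Let $\beta\in(0,1)$, $A<0$, $\alpha\in(1,2)$, $\gamma\in(0,1)$ with $\alpha+\gamma>2$, and $\tau$ with $\tau+\gamma>1$. Let $h:\mathbb{R}\to\mathbb{R}$ be measurable and suppose there is $C>0$ such that $A+C<0$ and $|h(x)|\le C|x|$ for all $x\in\mathbb{R}$. On a complete probability space $(\Omega,\mathcal{F},P)$, let $\mathcal{E}$ be a family of continuous real-valued processes $\xi=\{\xi_t,t\ge0\}$ and let $f,\theta$ be stochastic processes whose paths almost surely satisfy the conditions in the context. Suppose that the solution of $$Y(t)=\xi_t+\frac{1}{\Gamma(\beta)}\int_0^t (t-s)^{\beta-1}A Y(s)\,ds+\frac{1}{\Gamma(\alpha)}\int_0^t(t-s)^{\alpha-1}f(s)\,d\theta_s,\qquad t\ge0,$$ is globally $\mathcal{E}$-stable in the mean, i.e. $\mathbf{E}|Y(t)|\to0$ as $t\to\infty$ for every $\xi\in\mathcal{E}$. Then any continuous solution of $$X(t)=\xi_t+\frac{1}{\Gamma(\beta)}\int_0^t (t-s)^{\beta-1}[A X(s)+h(X(s))]\,ds+\frac{1}{\Gamma(\alpha)}\int_0^t(t-s)^{\alpha-1}f(s)\,d\theta_s,\qquad t\ge0,$$ is also globally $\mathcal{E}$-stable in the mean, i.e. $\mathbf{E}|X(t)|\to0$ as $t\to\infty$ for every $\xi\in\mathcal{E}$.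
   Context: $\Gamma$ is the Gamma function and $\mathbf{E}$ is expectation. Equations are interpreted path by path ($\omega$ by $\omega$). For almost all $\omega$: $\theta_\cdot(\omega)$ is $\gamma$-Hölder continuous on each compact interval $[0,T]$ with $\theta_0=0$, and $f(\omega,\cdot)\in C^1(\mathbb{R}_+)$ is $\tau$-Hölder continuous on each compact interval. Integrals $\int\cdot\,d\theta_s$ are pathwise Young integrals, i.e. limits of Riemann sums $\sum_i \phi_{t_i}(\theta_{t_{i+1}}-\theta_{t_i})$ as the mesh of the partition tends to $0$. The linear equation for $Y$ has a unique continuous solution path by path.
   Formalization: Added hypothesis: for each ξ in the family, the linear solution Y has ∫_0^T E|Y(t)|dt finite for all T>0. Without it the claim fails: f=θ=0, h(x)=Cx, Y(t)=Zφ(t) with Z≥0, EZ=∞ and φ a bump in (0,1) gives E|X(t)|=∞ for t>1. *)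

theory Defs
  imports "HOL-Probability.Probability"
begin

definition holder_on :: "real \<Rightarrow> real set \<Rightarrow> (real \<Rightarrow> real) \<Rightarrow> bool" where
  "holder_on g S u \<longleftrightarrow> (\<exists>K\<ge>0. \<forall>s\<in>S. \<forall>t\<in>S. \<bar>u s - u t\<bar> \<le> K * \<bar>s - t\<bar> powr g)"

text \<open>Derivatives are taken within \<open>[0, \<infinity>)\<close>, hence one-sided at the origin; the library's
  \<open>C1_differentiable_on\<close> uses two-sided derivatives and would constrain values at negative times.\<close>

definition C1_half_line :: "(real \<Rightarrow> real) \<Rightarrow> bool" where
  "C1_half_line u \<longleftrightarrow> (\<exists>D. (\<forall>t\<ge>0. (u has_real_derivative D t) (at t within {0..}))
                          \<and> continuous_on {0..} D)"

text \<open>\<open>p 0 < \<dots> < p n\<close> is a partition of \<open>[a, b]\<close>; the case \<open>n = 0\<close> occurs exactly when \<open>a = b\<close>.\<close>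

definition has_young_integral ::
    "(real \<Rightarrow> real) \<Rightarrow> (real \<Rightarrow> real) \<Rightarrow> real \<Rightarrow> real \<Rightarrow> real \<Rightarrow> bool" where
  "has_young_integral u v a b I \<longleftrightarrow>
     (\<forall>\<epsilon>>0. \<exists>\<delta>>0. \<forall>(n::nat) (p :: nat \<Rightarrow> real).
        p 0 = a \<and> p n = b \<and> (\<forall>i<n. p i < p (Suc i) \<and> p (Suc i) - p i < \<delta>)
        \<longrightarrow> \<bar>(\<Sum>i<n. u (p i) * (v (p (Suc i)) - v (p i))) - I\<bar> < \<epsilon>)"

definition young_integral :: "(real \<Rightarrow> real) \<Rightarrow> (real \<Rightarrow> real) \<Rightarrow> real \<Rightarrow> real \<Rightarrow> real" where
  "young_integral u v a b = (THE I. has_young_integral u v a b I)"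

text \<open>A process has the half-line \<open>[0, \<infinity>)\<close> as its time set; its values at negative times are
  irrelevant.\<close>

definition process :: "'a measure \<Rightarrow> (real \<Rightarrow> 'a \<Rightarrow> real) \<Rightarrow> bool" where
  "process M Z \<longleftrightarrow> (\<forall>t\<ge>0. Z t \<in> borel_measurable M)"

definition continuous_process :: "'a measure \<Rightarrow> (real \<Rightarrow> 'a \<Rightarrow> real) \<Rightarrow> bool" where
  "continuous_process M Z \<longleftrightarrow> process M Z \<and> (AE \<omega> in M. continuous_on {0..} (\<lambda>t. Z t \<omega>))"

text \<open>\<open>Z\<close> is a continuous solution, path by path, of
  \[ Z(t) = \xi_t + \frac{1}{\Gamma(\beta)} \int_0^t (t-s)^{\beta-1} b(Z(s))\,ds
       + \frac{1}{\Gamma(\alpha)} \int_0^t (t-s)^{\alpha-1} f(s)\,d\theta_s, \qquad t \ge 0. \]\<close>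

definition solves ::
    "'a measure \<Rightarrow> real \<Rightarrow> real \<Rightarrow> (real \<Rightarrow> 'a \<Rightarrow> real) \<Rightarrow> (real \<Rightarrow> 'a \<Rightarrow> real) \<Rightarrow> (real \<Rightarrow> real)
      \<Rightarrow> (real \<Rightarrow> 'a \<Rightarrow> real) \<Rightarrow> (real \<Rightarrow> 'a \<Rightarrow> real) \<Rightarrow> bool" where
  "solves M \<beta> \<alpha> f \<theta> b \<xi> Z \<longleftrightarrow>
     continuous_process M Z \<and>
     (AE \<omega> in M. \<forall>t\<ge>0.
        Z t \<omega> = \<xi> t \<omega>
          + 1 / Gamma \<beta> * (LINT s:{0..t}|lborel. (t - s) powr (\<beta> - 1) * b (Z s \<omega>))
          + 1 / Gamma \<alpha> *
              young_integral (\<lambda>s. (t - s) powr (\<alpha> - 1) * f s \<omega>) (\<lambda>s. \<theta> s \<omega>) 0 t)"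

text \<open>The mean \<open>E \<bar>Z(t)\<bar>\<close> as an extended real: the Bochner integral would give the value \<open>0\<close>
  when \<open>Z(t)\<close> is not integrable.\<close>

definition abs_mean :: "'a measure \<Rightarrow> (real \<Rightarrow> 'a \<Rightarrow> real) \<Rightarrow> real \<Rightarrow> ennreal" where
  "abs_mean M Z t = (\<integral>\<^sup>+ \<omega>. ennreal \<bar>Z t \<omega>\<bar> \<partial>M)"

text \<open>\<open>sol \<xi> Z\<close> says that \<open>Z\<close> is a solution of the equation under consideration with datum \<open>\<xi>\<close>.\<close>

definition globally_stable_in_mean ::
    "'a measure \<Rightarrow> (real \<Rightarrow> 'a \<Rightarrow> real) set
      \<Rightarrow> ((real \<Rightarrow> 'a \<Rightarrow> real) \<Rightarrow> (real \<Rightarrow> 'a \<Rightarrow> real) \<Rightarrow> bool) \<Rightarrow> bool" where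
  "globally_stable_in_mean M E sol \<longleftrightarrow>
     (\<forall>\<xi>\<in>E. \<forall>Z. sol \<xi> Z \<longrightarrow> (abs_mean M Z \<longlongrightarrow> 0) at_top)"

end

theory Submission
  imports Defs
begin

text \<open>Let \<open>g\<close> be the kernel \<open>t powr (\<beta> - 1) / Gamma \<beta>\<close> and, for \<open>l > 0\<close>, let \<open>K\<^sub>l\<close> be its resolvent,
  \<open>K\<^sub>l + l * (g \<star> K\<^sub>l) = g\<close>. Because \<open>g\<close> is positive, decreasing and log-convex, \<open>0 \<le> K\<^sub>l \<le> g\<close>
  and \<open>K\<^sub>l\<close> has total mass at most \<open>1 / l\<close>. Given a solution \<open>X\<close> of the perturbed equation and
  \<open>a = - A\<close>, the process \<open>Y = X - K\<^sub>a \<star> h(X)\<close> solves the linear equation with the same data, since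
  the Young integral enters both equations in the same way. Hence
  \<open>\<bar>X\<bar> \<le> \<bar>Y\<bar> + C * (K\<^sub>a \<star> \<bar>X\<bar>)\<close> path by path, and convolving with \<open>K\<^sub>a\<^sub>-\<^sub>C = K\<^sub>a + C * (K\<^sub>a\<^sub>-\<^sub>C \<star> K\<^sub>a)\<close>
  gives \<open>\<bar>X\<bar> \<le> \<bar>Y\<bar> + C * (K\<^sub>a\<^sub>-\<^sub>C \<star> \<bar>Y\<bar>)\<close>. After taking expectations, the right-hand side tends to
  \<open>0\<close>, as \<open>K\<^sub>a\<^sub>-\<^sub>C\<close> is integrable and vanishes at infinity.\<close>

section \<open>Fractional kernels and their resolvents\<close>

text \<open>Kernels are extended by \<open>0\<close> to the whole line, so that convolution over \<open>[0, t]\<close> becomes an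
  integral over the real line.\<close>

definition riesz :: "real \<Rightarrow> real \<Rightarrow> real" where
  "riesz b t = (if 0 < t then t powr (b - 1) / Gamma b else 0)"

section \<open>The Riesz kernel and its semigroup law\<close>

lemma riesz_nonpos [simp]: "t \<le> 0 \<Longrightarrow> riesz b t = 0"
  by (simp add: riesz_def)

lemma riesz_pos: "0 < b \<Longrightarrow> 0 < t \<Longrightarrow> 0 < riesz b t"
  by (simp add: riesz_def)

lemma riesz_nonneg: "0 < b \<Longrightarrow> 0 \<le> riesz b t"
  by (simp add: riesz_def)

lemma borel_measurable_riesz [measurable]: "riesz b \<in> borel_measurable borel"
  unfolding riesz_def[abs_def] by measurable

lemma riesz_antimono:
  assumes "0 < b" "b \<le> 1" "0 < s" "s \<le> t"
  shows "riesz b t \<le> riesz b s"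
  using assms by (auto simp: riesz_def intro!: divide_right_mono powr_mono2')

lemma riesz_mono:
  assumes "1 \<le> b" "s \<le> t"
  shows "riesz b s \<le> riesz b t"
  using assms by (auto simp: riesz_def intro!: divide_right_mono powr_mono2)

text \<open>Semigroup law of fractional integration: the substitution \<open>s = t * x\<close> turns
  the convolution into a Beta integral, and the Gamma factors recombine.\<close>

lemma has_bochner_integral_riesz:
  assumes "0 < a" "0 < b"
  shows "has_bochner_integral lborel (\<lambda>s. riesz a (t - s) * riesz b s) (riesz (a + b) t)"
proof (cases "0 < t")
  case False
  then have "riesz a (t - s) * riesz b s = 0" for s
    by (cases "0 < s") auto
  then have "(\<lambda>s. riesz a (t - s) * riesz b s) = (\<lambda>s. 0)"
    by (intro ext)
  with False show ?thesis by (simp add: has_bochner_integral_zero)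
next
  case t: True
  define c where "c = t powr (a + b - 2) / (Gamma a * Gamma b)"
  have c0: "0 \<le> c" using assms by (simp add: c_def)
  have "(\<integral>\<^sup>+x. indicator {0..1} x * (x powr (b - 1) * (1 - x) powr (a - 1)) \<partial>lborel) = ennreal (Beta b a)"
    using assms by (intro nn_integral_has_integral_lebesgue has_integral_Beta_real) auto
  then have Beta: "(\<integral>\<^sup>+x. ennreal (indicator {0..1} x * (x powr (b - 1) * (1 - x) powr (a - 1))) \<partial>lborel)
      = ennreal (Beta b a)"
    by simp
  \<comment> \<open>At \<open>x = 0\<close> and \<open>x = 1\<close> both sides vanish, because
    \<open>0 powr _\<close> is \<open>0\<close> even for a negative exponent. So the identity holds
    at every \<open>x\<close>, not only almost everywhere.\<close>
  have *: "riesz a (t - t * x) * riesz b (t * x)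
      = c * (indicator {0..1} x * (x powr (b - 1) * (1 - x) powr (a - 1)))" for x
  proof (cases "0 < x \<and> x < 1")
    case True
    have tx: "t - t * x = t * (1 - x)" by (simp add: algebra_simps)
    have "riesz a (t - t * x) = (t * (1 - x)) powr (a - 1) / Gamma a"
      unfolding tx using t True by (simp add: riesz_def)
    moreover have "riesz b (t * x) = (t * x) powr (b - 1) / Gamma b"
      using t True by (simp add: riesz_def)
    moreover have "t powr (a + b - 2) = t powr (a - 1) * t powr (b - 1)"
      by (simp add: powr_add[symmetric] algebra_simps)
    ultimately show ?thesis
      using t True by (simp add: c_def powr_mult mult_ac)
  next
    case False
    then consider "x < 0" | "x = 0" | "x = 1" | "x > 1" by linarith
    then show ?thesis
      using t by cases (auto simp: mult_le_0_iff)
  qed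
  have "(\<integral>\<^sup>+s. ennreal (riesz a (t - s) * riesz b s) \<partial>lborel)
      = ennreal t * (\<integral>\<^sup>+x. ennreal (riesz a (t - t * x) * riesz b (t * x)) \<partial>lborel)"
    using t by (subst nn_integral_real_affine[where c = t and t = 0]) auto
  also have "\<dots> = ennreal t * (ennreal c * ennreal (Beta b a))"
    unfolding * by (subst ennreal_mult) (use c0 in \<open>auto simp: nn_integral_cmult Beta\<close>)
  also have "\<dots> = ennreal (t * (c * Beta b a))"
    using c0 t by (simp add: ennreal_mult' mult.assoc)
  also have "t * (c * Beta b a) = riesz (a + b) t"
  proof -
    have "t powr (a + b - 1) = t powr (a + b - 2) * t powr 1"
      unfolding powr_add[symmetric] by simp
    moreover have "Gamma a \<noteq> 0" "Gamma b \<noteq> 0"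
      using assms Gamma_real_pos by (metis less_irrefl)+
    ultimately show ?thesis
      using t assms by (simp add: c_def riesz_def Beta_def field_simps)
  qed
  finally show ?thesis
    using assms by (intro has_bochner_integral_nn_integral) (auto simp: riesz_nonneg)
qed

lemmas integrable_riesz = integrable.intros[OF has_bochner_integral_riesz]
lemmas integral_riesz = has_bochner_integral_integral_eq[OF has_bochner_integral_riesz]

text \<open>The point \<open>s + 1\<close> is the convex combination of \<open>s + b\<close> and
  \<open>s + b + 1\<close> with weights \<open>b\<close> and \<open>1 - b\<close>. Log-convexity of
  Gamma bounds \<open>Gamma (s + 1)\<close> by
  \<open>(s + b) powr (1 - b) * Gamma (s + b)\<close>.\<close>

lemma Gamma_ratio_bound:
  fixes b s :: real
  assumes b: "0 < b" "b < 1" and s: "0 < s"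
  shows "Gamma s / Gamma (s + b) \<le> (s + b) powr (1 - b) / s"
proof -
  have "(ln \<circ> Gamma) (b *\<^sub>R (s + b) + (1 - b) *\<^sub>R (s + b + 1))
      \<le> b * (ln \<circ> Gamma) (s + b) + (1 - b) * (ln \<circ> Gamma) (s + b + 1)"
    using assms convex_onD[OF log_convex_Gamma_real, of "1 - b" "s + b" "s + b + 1"] by simp
  moreover have "b *\<^sub>R (s + b) + (1 - b) *\<^sub>R (s + b + 1) = s + 1"
    by (simp add: algebra_simps)
  moreover have "Gamma (s + b + 1) = (s + b) * Gamma (s + b)" "Gamma (s + 1) = s * Gamma s"
    using assms by (auto intro!: Gamma_plus1 elim!: nonpos_Ints_cases')
  moreover have "Gamma s > 0" "Gamma (s + b) > 0"
    using assms by auto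
  ultimately have "ln (s * Gamma s) \<le> b * ln (Gamma (s + b)) + (1 - b) * ln ((s + b) * Gamma (s + b))"
    by simp
  also have "\<dots> = ln ((s + b) powr (1 - b) * Gamma (s + b))"
  proof -
    have "ln ((s + b) * Gamma (s + b)) = ln (s + b) + ln (Gamma (s + b))"
      "ln ((s + b) powr (1 - b) * Gamma (s + b)) = (1 - b) * ln (s + b) + ln (Gamma (s + b))"
      using assms \<open>Gamma (s + b) > 0\<close> less_imp_neq[OF \<open>Gamma (s + b) > 0\<close>]
      by (auto simp: ln_mult ln_powr)
    then show ?thesis by (simp add: algebra_simps)
  qed
  finally have "s * Gamma s \<le> (s + b) powr (1 - b) * Gamma (s + b)"
    using assms \<open>Gamma s > 0\<close> \<open>Gamma (s + b) > 0\<close> by (subst (asm) ln_le_cancel_iff) auto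
  then show ?thesis
    using s \<open>Gamma (s + b) > 0\<close> by (simp add: field_simps)
qed

text \<open>Ratio test: by \<open>Gamma_ratio_bound\<close> the quotient of consecutive terms is at
  most a multiple of \<open>real (Suc n) powr (- b)\<close>, which tends to \<open>0\<close>
  whatever \<open>x\<close> is.\<close>

lemma summable_Mittag_Leffler:
  fixes b x :: real
  assumes b: "0 < b" "b < 1"
  shows "summable (\<lambda>n. x ^ n / Gamma (b * real (Suc n)))"
proof -
  have "filterlim (\<lambda>n. b * real (Suc n)) at_top sequentially"
    using b by (intro filterlim_tendsto_pos_mult_at_top[OF tendsto_const] filterlim_compose[OF filterlim_real_sequentially filterlim_Suc]) auto
  then have "((\<lambda>n. \<bar>x\<bar> * (2 powr (1 - b) * (b * real (Suc n)) powr (- b))) \<longlongrightarrow> \<bar>x\<bar> * (2 powr (1 - b) * 0)) sequentially"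
    using b by (intro tendsto_intros tendsto_neg_powr) auto
  then have "eventually (\<lambda>n. \<bar>x\<bar> * (2 powr (1 - b) * (b * real (Suc n)) powr (- b)) < 1/2) sequentially"
    by (intro order_tendstoD) auto
  then obtain N where N: "\<And>n. n \<ge> N \<Longrightarrow> \<bar>x\<bar> * (2 powr (1 - b) * (b * real (Suc n)) powr (- b)) < 1/2"
    by (auto simp: eventually_sequentially)
  show ?thesis
  proof (rule summable_ratio_test[where c = "1/2" and N = N])
    fix n assume n: "N \<le> n"
    define s where "s = b * real (Suc n)"
    have s: "0 < s" "b \<le> s" using b by (auto simp: s_def)
    have s': "b * real (Suc (Suc n)) = s + b" by (simp add: s_def algebra_simps)
    have G: "Gamma s > 0" "Gamma (s + b) > 0" using s b by auto
    have "Gamma s / Gamma (s + b) \<le> (s + b) powr (1 - b) / s"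
      by (intro Gamma_ratio_bound b s)
    \<comment> \<open>Since \<open>b \<le> s\<close>, the sum \<open>s + b\<close> is at most
      \<open>2 * s\<close>; this is the source of the factor \<open>2 powr (1 - b)\<close>.\<close>
    also have "\<dots> \<le> (2 * s) powr (1 - b) / s"
      using s b by (intro divide_right_mono powr_mono2) auto
    also have "\<dots> = 2 powr (1 - b) * s powr (- b)"
      using s powr_add[of s 1 "-b"] by (simp add: powr_mult)
    finally have "\<bar>x\<bar> * (Gamma s / Gamma (s + b)) \<le> \<bar>x\<bar> * (2 powr (1 - b) * s powr (- b))"
      by (intro mult_left_mono) auto
    with N[OF n] have r: "\<bar>x\<bar> * (Gamma s / Gamma (s + b)) \<le> 1/2"
      unfolding s_def by linarith
    have "norm (x ^ Suc n / Gamma (b * real (Suc (Suc n)))) = \<bar>x\<bar> * (Gamma s / Gamma (s + b)) * norm (x ^ n / Gamma s)"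
      unfolding s' using G by (simp add: abs_mult power_abs)
    also have "\<dots> \<le> 1/2 * norm (x ^ n / Gamma s)"
      by (intro mult_right_mono r) auto
    finally show "norm (x ^ Suc n / Gamma (b * real (Suc (Suc n)))) \<le> 1/2 * norm (x ^ n / Gamma (b * real (Suc n)))"
      by (simp add: s_def)
  qed simp
qed

text \<open>In closed form the series is \<open>t powr (b - 1)\<close> times the two-parameter Mittag-Leffler function
  \<open>E\<^sub>b\<^sub>,\<^sub>b\<close> at \<open>- l * t powr b\<close>.\<close>

definition resolvent :: "real \<Rightarrow> real \<Rightarrow> real \<Rightarrow> real" where
  "resolvent b l t = (\<Sum>n. (- l) ^ n * riesz (b * real (Suc n)) t)"

lemma resolvent_nonpos [simp]: "t \<le> 0 \<Longrightarrow> resolvent b l t = 0"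
  by (simp add: resolvent_def)

lemma borel_measurable_resolvent [measurable]: "resolvent b l \<in> borel_measurable borel"
  unfolding resolvent_def[abs_def] by measurable

text \<open>Isolates the singularity at \<open>0\<close>: after division by
  \<open>riesz b t\<close>, the terms of the resolvent series form a power series in
  \<open>t powr b\<close>.\<close>

lemma riesz_Suc_eq:
  assumes "0 < b" "0 < t"
  shows "riesz (b * real (Suc n)) t = riesz b t * (Gamma b * ((t powr b) ^ n / Gamma (b * real (Suc n))))"
proof -
  have "t powr (b * real (Suc n) - 1) = t powr (b - 1) * t powr (b * real n)"
    by (simp add: powr_add[symmetric] algebra_simps)
  also have "t powr (b * real n) = (t powr b) ^ n"
    using assms by (simp add: powr_powr[symmetric] powr_realpow)
  finally show ?thesis
    using assms less_imp_neq[OF Gamma_real_pos[of b]] by (simp add: riesz_def del: of_nat_Suc)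
qed

lemma summable_resolvent:
  assumes b: "0 < b" "b < 1"
  shows "summable (\<lambda>n. \<bar>(- l) ^ n * riesz (b * real (Suc n)) t\<bar>)"
proof (cases "0 < t")
  case True
  have "summable (\<lambda>n. riesz b t * (Gamma b * ((\<bar>l\<bar> * t powr b) ^ n / Gamma (b * real (Suc n)))))"
    by (intro summable_mult summable_Mittag_Leffler b)
  also have "(\<lambda>n. riesz b t * (Gamma b * ((\<bar>l\<bar> * t powr b) ^ n / Gamma (b * real (Suc n)))))
     = (\<lambda>n. \<bar>(- l) ^ n * riesz (b * real (Suc n)) t\<bar>)"
    using b True
    by (intro ext) (simp add: riesz_Suc_eq[OF _ True] abs_mult power_mult_distrib power_abs riesz_nonneg del: of_nat_Suc)
  finally show ?thesis .
qed simp

text \<open>Once \<open>riesz b t\<close> is factored out, the series of absolute values increases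
  with \<open>t\<close>, so its value at \<open>T\<close> serves as the constant. This crude bound
  starts the positivity argument.\<close>

lemma resolvent_bound:
  assumes b: "0 < b" "b < 1"
  obtains c where "0 \<le> c" "\<And>t. t \<le> T \<Longrightarrow> \<bar>resolvent b l t\<bar> \<le> c * riesz b t"
proof
  let ?f = "\<lambda>n. (\<bar>l\<bar> * T powr b) ^ n / Gamma (b * real (Suc n))"
  have f0: "0 \<le> ?f n" for n
    using b by (intro divide_nonneg_nonneg) auto
  show "0 \<le> Gamma b * suminf ?f"
    using b by (intro mult_nonneg_nonneg suminf_nonneg summable_Mittag_Leffler f0) auto
  fix t assume "t \<le> T"
  show "\<bar>resolvent b l t\<bar> \<le> Gamma b * suminf ?f * riesz b t"
  proof (cases "0 < t")
    case True
    have "\<bar>resolvent b l t\<bar> \<le> (\<Sum>n. \<bar>(- l) ^ n * riesz (b * real (Suc n)) t\<bar>)"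
      unfolding resolvent_def by (intro summable_rabs summable_resolvent b)
    also have "\<dots> \<le> (\<Sum>n. riesz b t * Gamma b * ?f n)"
    proof (intro suminf_le summable_resolvent summable_mult summable_Mittag_Leffler b)
      fix n
      have "\<bar>(- l) ^ n * riesz (b * real (Suc n)) t\<bar> = riesz b t * Gamma b * ((\<bar>l\<bar> * t powr b) ^ n / Gamma (b * real (Suc n)))"
        using b True by (simp add: riesz_Suc_eq[OF _ True] abs_mult power_mult_distrib power_abs riesz_nonneg del: of_nat_Suc)
      also have "\<dots> \<le> riesz b t * Gamma b * ?f n"
        using b True \<open>t \<le> T\<close>
        by (intro mult_left_mono divide_right_mono power_mono powr_mono2 mult_nonneg_nonneg riesz_nonneg) auto
      finally show "\<bar>(- l) ^ n * riesz (b * real (Suc n)) t\<bar> \<le> riesz b t * Gamma b * ?f n" .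
    qed
    also have "\<dots> = riesz b t * Gamma b * suminf ?f"
      by (intro suminf_mult summable_Mittag_Leffler b)
    finally show ?thesis by (simp add: mult_ac)
  qed simp
qed

text \<open>By the semigroup law, convolving the series with \<open>riesz b\<close> and multiplying
  by \<open>- l\<close> shifts it by one term, leaving out only the leading term
  \<open>riesz b t\<close>. Summable L1 norms justify termwise integration.\<close>

lemma resolvent_equation:
  assumes b: "0 < b" "b < 1"
  shows "integrable lborel (\<lambda>s. riesz b (t - s) * resolvent b l s)"
    and "resolvent b l t = riesz b t - l * (LINT s|lborel. riesz b (t - s) * resolvent b l s)"
proof -
  let ?f = "\<lambda>n s. (- l) ^ n * (riesz b (t - s) * riesz (b * real (Suc n)) s)"
  have bS: "0 < b * real (Suc n)" for n using b by simp
  have int: "integrable lborel (?f n)" for n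
    by (intro integrable_mult_right integrable_riesz bS b)
  have bSS: "b + b * real (Suc n) = b * real (Suc (Suc n))" for n
    by (simp add: algebra_simps)
  have I: "(LINT s|lborel. ?f n s) = (- l) ^ n * riesz (b * real (Suc (Suc n))) t" for n
    using integral_riesz[OF b(1) bS, of t n] by (simp only: bSS integral_mult_right_zero)
  have N: "(LINT s|lborel. norm (?f n s)) = \<bar>l\<bar> ^ n * riesz (b * real (Suc (Suc n))) t" for n
  proof -
    have "norm (?f n s) = \<bar>l\<bar> ^ n * (riesz b (t - s) * riesz (b * real (Suc n)) s)" for s
      using riesz_nonneg[OF b(1)] riesz_nonneg[OF bS] by (simp add: abs_mult power_abs)
    then show ?thesis
      using integral_riesz[OF b(1) bS, of t n] by (simp only: bSS integral_mult_right_zero)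
  qed
  have "summable (\<lambda>n. \<bar>(- l) ^ Suc n * riesz (b * real (Suc (Suc n))) t\<bar>)"
    using summable_resolvent[OF b, of l t] by (subst summable_Suc_iff)
  then have "summable (\<lambda>n. \<bar>l\<bar> * (\<bar>l\<bar> ^ n * riesz (b * real (Suc (Suc n))) t))"
    by (simp add: abs_mult power_abs mult.assoc abs_of_nonneg[OF riesz_nonneg[OF bS]] del: of_nat_Suc)
  \<comment> \<open>The summability just obtained carries an extra factor
    \<open>\<bar>l\<bar>\<close>, which can be cancelled only for nonzero \<open>l\<close>; for
    \<open>l = 0\<close> the series has a single nonzero term.\<close>
  then have sN: "summable (\<lambda>n. LINT s|lborel. norm (?f n s))"
    unfolding N by (cases "l = 0") (auto simp: summable_cmult_iff intro: summable_finite[of "{0}"])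
  have sm: "summable (\<lambda>n. norm (?f n s))" for s
  proof -
    have "summable (\<lambda>n. riesz b (t - s) * \<bar>(- l) ^ n * riesz (b * real (Suc n)) s\<bar>)"
      by (intro summable_mult summable_resolvent b)
    then show ?thesis
      using riesz_nonneg[OF b(1)] by (simp add: abs_mult mult_ac)
  qed
  have su: "(\<Sum>n. ?f n s) = riesz b (t - s) * resolvent b l s" for s
    unfolding resolvent_def using summable_rabs_cancel[OF summable_resolvent[OF b, of l s]]
    by (subst suminf_mult[symmetric]) (auto simp: mult_ac)
  have ae: "AE s in lborel. summable (\<lambda>n. norm (?f n s))" using sm by simp
  show "integrable lborel (\<lambda>s. riesz b (t - s) * resolvent b l s)"
    using integrable_suminf[OF int ae sN] by (simp only: su)
  have "(\<lambda>n. LINT s|lborel. ?f n s) sums (LINT s|lborel. riesz b (t - s) * resolvent b l s)"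
    using sums_integral[OF int ae sN] by (simp only: su)
  then have "(\<lambda>n. (- l) * ((- l) ^ n * riesz (b * real (Suc (Suc n))) t))
      sums ((- l) * (LINT s|lborel. riesz b (t - s) * resolvent b l s))"
    unfolding I by (rule sums_mult)
  then have "(\<lambda>n. (- l) ^ Suc n * riesz (b * real (Suc (Suc n))) t)
      sums ((- l) * (LINT s|lborel. riesz b (t - s) * resolvent b l s))"
    by (simp add: mult.assoc)
  then have "(\<lambda>n. (- l) ^ n * riesz (b * real (Suc n)) t)
      sums ((- l) * (LINT s|lborel. riesz b (t - s) * resolvent b l s) + (- l) ^ 0 * riesz (b * real (Suc 0)) t)"
    by (rule sums_Suc)
  then have "resolvent b l t = (- l) * (LINT s|lborel. riesz b (t - s) * resolvent b l s) + riesz b t"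
    unfolding resolvent_def by (auto dest: sums_unique)
  then show "resolvent b l t = riesz b t - l * (LINT s|lborel. riesz b (t - s) * resolvent b l s)"
    by simp
qed

section \<open>Positivity of the resolvent\<close>

text \<open>In other words, \<open>riesz b (t - r) / riesz b t\<close> decreases in
  \<open>t\<close>. It comes from \<open>(p - r) * q \<le> (q - r) * p\<close>, reversed by the
  nonpositive exponent \<open>b - 1\<close>.\<close>

lemma riesz_log_convex:
  assumes "0 < b" "b \<le> 1" "0 \<le> r" "r < p" "p \<le> q"
  shows "riesz b (q - r) * riesz b p \<le> riesz b (p - r) * riesz b q"
proof -
  have "(p - r) * q \<le> (q - r) * p"
    using assms mult_left_mono[of p q r] by (simp add: algebra_simps)
  then have "((q - r) * p) powr (b - 1) \<le> ((p - r) * q) powr (b - 1)"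
    using assms by (intro powr_mono2') auto
  then show ?thesis
    using assms by (simp add: riesz_def powr_mult divide_right_mono)
qed

text \<open>The quotient of the two kernels is a constant times \<open>t powr c\<close>, which
  vanishes at \<open>0\<close>.\<close>

lemma riesz_add_small:
  assumes "0 < b" "0 < c" "0 \<le> k"
  obtains T where "0 < T" "\<And>t. 0 < t \<Longrightarrow> t \<le> T \<Longrightarrow> k * riesz (b + c) t \<le> riesz b t"
proof
  \<comment> \<open>The summand \<open>1\<close> keeps \<open>q\<close> positive when
    \<open>k = 0\<close>, so that \<open>1 / q\<close> is meaningful.\<close>
  define q where "q = k * Gamma b / Gamma (b + c) + 1"
  have q: "0 < q"
    unfolding q_def using assms by (intro add_nonneg_pos divide_nonneg_nonneg mult_nonneg_nonneg) auto
  show "0 < (1 / q) powr (1 / c)"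
    using q by simp
  fix t assume t: "0 < t" "t \<le> (1 / q) powr (1 / c)"
  have "t powr c \<le> ((1 / q) powr (1 / c)) powr c"
    using t assms by (intro powr_mono2) auto
  also have "\<dots> = 1 / q"
    using assms q by (simp add: powr_powr)
  finally have "q * t powr c \<le> 1"
    using q by (simp add: field_simps)
  moreover have "k * Gamma b / Gamma (b + c) * t powr c \<le> q * t powr c"
    by (intro mult_right_mono) (auto simp: q_def)
  ultimately have *: "k * Gamma b / Gamma (b + c) * t powr c \<le> 1" by linarith
  have "t powr (b + c - 1) = t powr (b - 1) * t powr c"
    by (simp add: powr_add[symmetric] algebra_simps)
  then have "k * riesz (b + c) t = riesz b t * (k * Gamma b / Gamma (b + c) * t powr c)"
    using t assms less_imp_neq[OF Gamma_real_pos[of b]] by (simp add: riesz_def)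
  also have "\<dots> \<le> riesz b t * 1"
    by (intro mult_left_mono * riesz_nonneg assms)
  finally show "k * riesz (b + c) t \<le> riesz b t" by simp
qed

text \<open>A bound \<open>- m * riesz b\<close> from below, fed twice into the equation, improves to
  \<open>- (m / 2) * riesz b\<close>; the first substitution bounds \<open>u\<close> from above, and there the monotonicity
  of \<open>F / riesz b\<close> lets \<open>F\<close> absorb the convolution \<open>riesz b * F\<close>.\<close>

lemma volterra_nonneg_local:
  fixes u F :: "real \<Rightarrow> real"
  assumes b: "0 < b" and l: "0 < l"
    and int: "\<And>t. 0 < t \<Longrightarrow> t \<le> T \<Longrightarrow> integrable lborel (\<lambda>s. riesz b (t - s) * u s)"
    and u0: "\<And>s. s \<le> 0 \<Longrightarrow> u s = 0"
    and eq: "\<And>t. 0 < t \<Longrightarrow> t \<le> T \<Longrightarrow> u t = F t - l * (LINT s|lborel. riesz b (t - s) * u s)"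
    and bd: "\<And>t. 0 < t \<Longrightarrow> t \<le> T \<Longrightarrow> - m * riesz b t \<le> u t"
    and F0: "\<And>t. 0 < t \<Longrightarrow> t \<le> T \<Longrightarrow> 0 \<le> F t"
    and Fmono: "\<And>s t. 0 < s \<Longrightarrow> s \<le> t \<Longrightarrow> t \<le> T \<Longrightarrow> F s * riesz b t \<le> F t * riesz b s"
    and T1: "\<And>t. 0 < t \<Longrightarrow> t \<le> T \<Longrightarrow> l * riesz (b + b) t \<le> riesz b t"
    and T2: "\<And>t. 0 < t \<Longrightarrow> t \<le> T \<Longrightarrow> 2 * l\<^sup>2 * riesz (b + (b + b)) t \<le> riesz b t"
    and t: "0 < t" "t \<le> T"
  shows "0 \<le> u t"
proof -
  have step: "- (m / 2) * riesz b t \<le> u t"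
    if "0 \<le> m" and bd: "\<And>t. 0 < t \<Longrightarrow> t \<le> T \<Longrightarrow> - m * riesz b t \<le> u t" and t: "0 < t" "t \<le> T" for m t
  proof -
    have up: "u s \<le> F s + l * m * riesz (b + b) s" if s: "0 < s" "s \<le> T" for s
    proof -
      have "(LINT r|lborel. - m * (riesz b (s - r) * riesz b r)) \<le> (LINT r|lborel. riesz b (s - r) * u r)"
      proof (intro integral_mono int integrable_mult_right integrable_riesz b s)
        fix r
        consider "r \<le> 0" | "s \<le> r" | "0 < r" "r < s" by linarith
        then show "- m * (riesz b (s - r) * riesz b r) \<le> riesz b (s - r) * u r"
        proof cases
          case 3
          then have "riesz b (s - r) * (- m * riesz b r) \<le> riesz b (s - r) * u r"
            using s by (intro mult_left_mono bd riesz_nonneg b) auto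
          then show ?thesis by (simp add: mult_ac)
        qed (auto simp: u0)
      qed
      then have "- m * riesz (b + b) s \<le> (LINT r|lborel. riesz b (s - r) * u r)"
        by (simp only: integral_mult_right_zero integral_riesz[OF b b])
      then have "l * (- m * riesz (b + b) s) \<le> l * (LINT r|lborel. riesz b (s - r) * u r)"
        using l by (intro mult_left_mono) auto
      then show ?thesis using eq[OF s] by (simp add: algebra_simps)
    qed
    \<comment> \<open>By \<open>Fmono\<close> the quotient \<open>F s / riesz b s\<close> increases
      in \<open>s\<close>, so \<open>k * riesz b s\<close> dominates \<open>F s\<close> for all
      \<open>s\<close> up to \<open>t\<close>.\<close>
    define k where "k = F t / riesz b t"
    have gt: "0 < riesz b t" using b t by (intro riesz_pos)
    have k0: "0 \<le> k" unfolding k_def using F0[OF t] gt by simp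
    have "(LINT s|lborel. riesz b (t - s) * u s)
      \<le> (LINT s|lborel. k * (riesz b (t - s) * riesz b s) + l * m * (riesz b (t - s) * riesz (b + b) s))"
    proof (intro integral_mono int integrable_mult_right integrable_riesz Bochner_Integration.integrable_add b t add_pos_pos)
      fix s
      consider "s \<le> 0" | "t \<le> s" | "0 < s" "s < t" by linarith
      then show "riesz b (t - s) * u s \<le> k * (riesz b (t - s) * riesz b s) + l * m * (riesz b (t - s) * riesz (b + b) s)"
      proof cases
        case 3
        have "F s \<le> k * riesz b s"
          using Fmono[of s t] 3 t gt by (simp add: k_def field_simps)
        then have "u s \<le> k * riesz b s + l * m * riesz (b + b) s"
          using up[of s] 3 t by simp
        then have "riesz b (t - s) * u s \<le> riesz b (t - s) * (k * riesz b s + l * m * riesz (b + b) s)"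
          by (intro mult_left_mono riesz_nonneg b)
        then show ?thesis by (simp add: algebra_simps)
      qed (auto simp: u0)
    qed
    also have "\<dots> = k * riesz (b + b) t + l * m * riesz (b + (b + b)) t"
      using b by (subst Bochner_Integration.integral_add)
        (auto intro!: integrable_mult_right integrable_riesz simp only: integral_mult_right_zero integral_riesz add_pos_pos)
    finally have "l * (LINT s|lborel. riesz b (t - s) * u s) \<le> l * (k * riesz (b + b) t + l * m * riesz (b + (b + b)) t)"
      using l by (intro mult_left_mono) auto
    also have "\<dots> = k * (l * riesz (b + b) t) + m / 2 * (2 * l\<^sup>2 * riesz (b + (b + b)) t)"
      by (simp add: algebra_simps power2_eq_square)
    \<comment> \<open>\<open>T1\<close> bounds the first term by exactly \<open>F t\<close>, which
      cancels the forcing; \<open>T2\<close> makes the remaining loss half of the original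
      one.\<close>
    also have "\<dots> \<le> k * riesz b t + m / 2 * riesz b t"
      using k0 \<open>0 \<le> m\<close> by (intro add_mono mult_left_mono T1 T2 t) auto
    also have "k * riesz b t = F t" using gt by (simp add: k_def)
    finally show ?thesis using eq[OF t] by simp
  qed
  \<comment> \<open>The halving step requires a nonnegative constant. Iterating it drives the lower
    bound to \<open>0\<close>.\<close>
  define m' where "m' = max m 0"
  have "\<forall>t. 0 < t \<and> t \<le> T \<longrightarrow> - (m' / 2 ^ n) * riesz b t \<le> u t" for n
  proof (induction n)
    case 0
    show ?case
    proof safe
      fix t assume t: "0 < t" "t \<le> T"
      have "- m' * riesz b t \<le> - m * riesz b t"
        by (intro mult_right_mono riesz_nonneg b) (auto simp: m'_def)
      with bd[OF t] show "- (m' / 2 ^ 0) * riesz b t \<le> u t" by simp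
    qed
  next
    case (Suc n)
    have "- (m' / 2 ^ n / 2) * riesz b t \<le> u t" if "0 < t" "t \<le> T" for t
      using Suc that by (intro step) (auto simp: m'_def)
    then show ?case by (simp add: field_simps)
  qed
  then have "- (m' / 2 ^ n) * riesz b t \<le> u t" for n using t by blast
  moreover have "(\<lambda>n. - (m' / 2 ^ n) * riesz b t) \<longlonglongrightarrow> - 0 * riesz b t"
    by (intro tendsto_intros LIMSEQ_divide_realpow_zero) auto
  ultimately show ?thesis
    by (intro LIMSEQ_le_const2[of _ 0]) auto
qed

text \<open>Restart at \<open>t0\<close>: splitting the convolution there, the shifted resolvent
  \<open>u\<close> solves a Volterra equation whose forcing \<open>F\<close> collects the past.
  Since the resolvent is nonnegative up to \<open>t0\<close>, log-convexity makes \<open>F\<close>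
  monotone relative to the kernel, and \<open>F\<close> starts from the nonnegative value
  \<open>resolvent b l t0\<close>; so the local lemma applies.\<close>

lemma resolvent_nonneg_extend:
  assumes b: "0 < b" "b < 1" and l: "0 < l"
    and T1: "\<And>t. 0 < t \<Longrightarrow> t \<le> T \<Longrightarrow> l * riesz (b + b) t \<le> riesz b t"
    and T2: "\<And>t. 0 < t \<Longrightarrow> t \<le> T \<Longrightarrow> 2 * l\<^sup>2 * riesz (b + (b + b)) t \<le> riesz b t"
    and t0: "0 \<le> t0" and nonneg: "\<And>s. s \<le> t0 \<Longrightarrow> 0 \<le> resolvent b l s"
    and s: "s \<le> t0 + T"
  shows "0 \<le> resolvent b l s"
proof (cases "s \<le> t0")
  case False
  let ?g = "riesz b" and ?K = "resolvent b l"
  define F where "F t = ?g (t0 + t) - l * (LINT r|lborel. ?g (t0 + t - r) * ?K r * indicator {..t0} r)" for t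
  define u where "u s = (if 0 < s then ?K (t0 + s) else 0)" for s
  have int: "integrable lborel (\<lambda>r. ?g (t - r) * ?K r)" for t
    by (intro resolvent_equation b)
  have intl: "integrable lborel (\<lambda>r. ?g (t - r) * ?K r * indicator {..t0} r)" for t
    using integrable_mult_indicator[OF _ int, of "{..t0}"] by (simp add: mult_ac)
  have intr: "integrable lborel (\<lambda>r. ?g (t - r) * ?K r * indicator {t0<..} r)" for t
    using integrable_mult_indicator[OF _ int, of "{t0<..}"] by (simp add: mult_ac)
  have shift: "?g (t0 + t - (t0 + 1 * r)) * ?K (t0 + 1 * r) * indicator {t0<..} (t0 + 1 * r) = ?g (t - r) * u r" for t r
    by (simp add: u_def)
  have intu: "integrable lborel (\<lambda>s. ?g (t - s) * u s)" for t
    using lborel_integrable_real_affine[OF intr, of 1 "t0 + t" t0] unfolding shift by simp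
  have I: "(LINT r|lborel. ?g (t0 + t - r) * ?K r * indicator {t0<..} r) = (LINT s|lborel. ?g (t - s) * u s)" for t
    using lborel_integral_real_affine[of 1 "\<lambda>r. ?g (t0 + t - r) * ?K r * indicator {t0<..} r" t0] unfolding shift by simp
  have split: "?K (t0 + t) = F t - l * (LINT s|lborel. ?g (t - s) * u s)" for t
  proof -
    have "(LINT r|lborel. ?g (t0 + t - r) * ?K r) = (LINT r|lborel. ?g (t0 + t - r) * ?K r * indicator {..t0} r
        + ?g (t0 + t - r) * ?K r * indicator {t0<..} r)"
      by (intro Bochner_Integration.integral_cong) (auto split: split_indicator)
    also have "\<dots> = (LINT r|lborel. ?g (t0 + t - r) * ?K r * indicator {..t0} r) + (LINT s|lborel. ?g (t - s) * u s)"
      by (subst Bochner_Integration.integral_add[OF intl intr]) (simp add: I)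
    finally show ?thesis
      using resolvent_equation(2)[OF b, of l "t0 + t"] by (simp add: F_def algebra_simps)
  qed
  have Fmono: "F s * ?g (t0 + t) \<le> F t * ?g (t0 + s)" if "0 \<le> s" "s \<le> t" for s t
  proof -
    have "(LINT r|lborel. ?g (t0 + s) * (?g (t0 + t - r) * ?K r * indicator {..t0} r))
      \<le> (LINT r|lborel. ?g (t0 + t) * (?g (t0 + s - r) * ?K r * indicator {..t0} r))"
    proof (intro integral_mono_AE integrable_mult_right intl)
      \<comment> \<open>For \<open>s = 0\<close> and \<open>r = t0\<close> the kernel on the right
        is \<open>riesz b 0 = 0\<close> and the inequality can fail, so this point is removed as a
        null set.\<close>
      have "AE r in lborel. r \<noteq> t0" by (rule AE_lborel_singleton)
      then show "AE r in lborel. ?g (t0 + s) * (?g (t0 + t - r) * ?K r * indicator {..t0} r)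
          \<le> ?g (t0 + t) * (?g (t0 + s - r) * ?K r * indicator {..t0} r)"
      proof eventually_elim
        case (elim r)
        consider "r \<le> 0" | "t0 < r" | "0 < r" "r < t0" using elim by linarith
        then show ?case
        proof cases
          case 3
          have "?g (t0 + t - r) * ?g (t0 + s) * ?K r \<le> ?g (t0 + s - r) * ?g (t0 + t) * ?K r"
            using 3 that b nonneg[of r] by (intro mult_right_mono riesz_log_convex) auto
          then show ?thesis using 3 by (simp add: mult_ac)
        qed auto
      qed
    qed
    then have "?g (t0 + s) * (LINT r|lborel. ?g (t0 + t - r) * ?K r * indicator {..t0} r)
        \<le> ?g (t0 + t) * (LINT r|lborel. ?g (t0 + s - r) * ?K r * indicator {..t0} r)"
      by (simp only: integral_mult_right_zero)
    then have "l * (?g (t0 + s) * (LINT r|lborel. ?g (t0 + t - r) * ?K r * indicator {..t0} r))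
        \<le> l * (?g (t0 + t) * (LINT r|lborel. ?g (t0 + s - r) * ?K r * indicator {..t0} r))"
      using l by (intro mult_left_mono) auto
    then show ?thesis by (simp add: F_def algebra_simps)
  qed
  have F0: "0 \<le> F t" if t: "0 < t" for t
  \<comment> \<open>For \<open>t0 = 0\<close> there is no past and \<open>F\<close> is
    \<open>riesz b\<close> itself. This case is separate because \<open>riesz b 0\<close> is
    \<open>0\<close> by convention, so division by \<open>riesz b t0\<close> is impossible.\<close>
  proof (cases "t0 = 0")
    case True
    then have "(\<lambda>r. ?g (t0 + t - r) * ?K r * indicator {..t0} r) = (\<lambda>r. 0)"
      by (auto split: split_indicator)
    then show ?thesis using b unfolding F_def by (simp add: riesz_nonneg)
  next
    case False
    have "(\<lambda>s. ?g (0 - s) * u s) = (\<lambda>s. 0)" by (auto simp: u_def)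
    then have "F 0 = ?K t0" using split[of 0] by simp
    then have "0 \<le> F 0" using nonneg by simp
    then have "0 \<le> F 0 * ?g (t0 + t)" using b by (intro mult_nonneg_nonneg riesz_nonneg)
    also have "\<dots> \<le> F t * ?g (t0 + 0)" using t by (intro Fmono) auto
    finally show ?thesis
      using riesz_pos[OF b(1), of t0] False t0 by (simp add: zero_le_mult_iff)
  qed
  obtain c where c: "0 \<le> c" "\<And>t. t \<le> t0 + T \<Longrightarrow> \<bar>?K t\<bar> \<le> c * ?g t"
    using resolvent_bound[OF b, of "t0 + T" l] by blast
  have "0 \<le> u (s - t0)"
  proof (rule volterra_nonneg_local[where u = u and F = F and T = T and m = c and b = b and l = l])
    fix t assume t: "0 < t" "t \<le> T"
    show "u t = F t - l * (LINT s|lborel. ?g (t - s) * u s)"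
      using split[of t] t by (simp add: u_def)
    have "- u t \<le> c * ?g (t0 + t)"
      using c(2)[of "t0 + t"] t by (auto simp: u_def)
    also have "\<dots> \<le> c * ?g t"
      using t t0 b c by (intro mult_left_mono riesz_antimono) auto
    finally show "- c * ?g t \<le> u t" by simp
  next
    fix s t assume st: "0 < s" "s \<le> t" "t \<le> T"
    have g: "0 < ?g (t0 + s)" using st t0 b by (intro riesz_pos) auto
    \<comment> \<open>\<open>Fmono\<close> compares \<open>F\<close> with the shifted kernel
      \<open>riesz b (t0 + t)\<close>. A second use of log-convexity, with \<open>r = t0\<close>,
      passes to the unshifted kernel required by the local lemma.\<close>
    have "?g (t0 + s) * (F s * ?g t) = F s * (?g (t0 + t - t0) * ?g (t0 + s))" by simp
    also have "\<dots> \<le> F s * (?g (t0 + s - t0) * ?g (t0 + t))"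
      using st t0 b by (intro mult_left_mono riesz_log_convex F0) auto
    also have "\<dots> = (F s * ?g (t0 + t)) * ?g s" by simp
    also have "\<dots> \<le> (F t * ?g (t0 + s)) * ?g s"
      using st b by (intro mult_right_mono Fmono riesz_nonneg) auto
    also have "\<dots> = ?g (t0 + s) * (F t * ?g s)" by simp
    finally show "F s * ?g t \<le> F t * ?g s" using g by simp
  qed (use b l T1 T2 F0 intu s False in \<open>auto simp: u_def\<close>)
  then show ?thesis using False by (simp add: u_def)
qed (use nonneg in auto)

text \<open>The admissible step \<open>T\<close> depends only on \<open>b\<close> and
  \<open>l\<close>, not on the restart time, so finitely many extensions reach any
  \<open>t\<close>.\<close>

lemma resolvent_nonneg:
  assumes b: "0 < b" "b < 1" and l: "0 < l"
  shows "0 \<le> resolvent b l t"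
proof -
  obtain T1 where T1: "0 < T1" "\<And>t. 0 < t \<Longrightarrow> t \<le> T1 \<Longrightarrow> l * riesz (b + b) t \<le> riesz b t"
    using riesz_add_small[of b b l] b l by auto
  obtain T2 where T2: "0 < T2" "\<And>t. 0 < t \<Longrightarrow> t \<le> T2 \<Longrightarrow> 2 * l\<^sup>2 * riesz (b + (b + b)) t \<le> riesz b t"
    using riesz_add_small[of b "b + b" "2 * l\<^sup>2"] b l by auto
  define T where "T = min T1 T2"
  have T: "0 < T" using T1 T2 by (simp add: T_def)
  have T1': "l * riesz (b + b) t \<le> riesz b t" and T2': "2 * l\<^sup>2 * riesz (b + (b + b)) t \<le> riesz b t"
    if "0 < t" "t \<le> T" for t
    using T1(2)[of t] T2(2)[of t] that by (auto simp: T_def)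
  have "\<forall>s\<le>real n * T. 0 \<le> resolvent b l s" for n
  proof (induction n)
    case (Suc n)
    show ?case
    proof safe
      fix s assume "s \<le> real (Suc n) * T"
      then have *: "s \<le> real n * T + T" by (simp add: algebra_simps)
      show "0 \<le> resolvent b l s"
        by (rule resolvent_nonneg_extend[where T = T and ?t0.0 = "real n * T", OF b l T1' T2'])
          (use Suc T * in auto)
    qed
  qed simp
  moreover obtain n where "t \<le> real n * T"
    using reals_Archimedean3[OF T] by (metis less_imp_le)
  ultimately show ?thesis by blast
qed

lemma resolvent_le_riesz:
  assumes b: "0 < b" "b < 1" and l: "0 < l"
  shows "resolvent b l t \<le> riesz b t"
proof -
  have "0 \<le> (LINT s|lborel. riesz b (t - s) * resolvent b l s)"
    using assms by (intro integral_nonneg_AE AE_I2 mult_nonneg_nonneg riesz_nonneg resolvent_nonneg)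
  then show ?thesis
    using resolvent_equation(2)[OF b, of l t] l by simp
qed

section \<open>Convolution of nonnegative functions\<close>

text \<open>Values in \<open>ennreal\<close> make commutativity and associativity hold by Tonelli
  for all measurable functions, without integrability conditions.\<close>

definition nconv :: "(real \<Rightarrow> ennreal) \<Rightarrow> (real \<Rightarrow> ennreal) \<Rightarrow> real \<Rightarrow> ennreal" where
  "nconv f k t = (\<integral>\<^sup>+ s. f (t - s) * k s \<partial>lborel)"

lemma borel_measurable_nconv [measurable]:
  assumes [measurable]: "f \<in> borel_measurable borel" "k \<in> borel_measurable borel"
  shows "nconv f k \<in> borel_measurable borel"
  unfolding nconv_def[abs_def] by measurable

lemma nconv_commute:
  assumes [measurable]: "f \<in> borel_measurable borel" "k \<in> borel_measurable borel"
  shows "nconv f k t = nconv k f t"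
proof -
  have "nconv f k t = (\<integral>\<^sup>+ s. f (t - (t + - 1 * s)) * k (t + - 1 * s) \<partial>lborel)"
    unfolding nconv_def by (subst nn_integral_real_affine[where c = "- 1" and t = t]) auto
  then show ?thesis by (simp add: nconv_def mult.commute)
qed

lemma nconv_assoc:
  assumes [measurable]: "f \<in> borel_measurable borel" "k \<in> borel_measurable borel" "u \<in> borel_measurable borel"
  shows "nconv (nconv f k) u t = nconv f (nconv k u) t"
proof -
  have "nconv (nconv f k) u t = (\<integral>\<^sup>+ s. (\<integral>\<^sup>+ r. f (t - s - r) * k r * u s \<partial>lborel) \<partial>lborel)"
    unfolding nconv_def by (simp add: nn_integral_multc)
  also have "\<dots> = (\<integral>\<^sup>+ s. (\<integral>\<^sup>+ r. f (t - r) * k (r - s) * u s \<partial>lborel) \<partial>lborel)"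
  proof -
    have "(\<integral>\<^sup>+ r. f (t - s - r) * k r * u s \<partial>lborel) = (\<integral>\<^sup>+ r. f (t - r) * k (r - s) * u s \<partial>lborel)" for s
      by (subst nn_integral_real_affine[where c = 1 and t = s and f = "\<lambda>r. f (t - r) * k (r - s) * u s"])
        (auto simp: diff_diff_eq)
    then show ?thesis by simp
  qed
  also have "\<dots> = (\<integral>\<^sup>+ r. (\<integral>\<^sup>+ s. f (t - r) * k (r - s) * u s \<partial>lborel) \<partial>lborel)"
    by (rule lborel_pair.Fubini') simp
  also have "\<dots> = nconv f (nconv k u) t"
    unfolding nconv_def by (simp add: nn_integral_cmult mult.assoc)
  finally show ?thesis .
qed

lemma nconv_add_left:
  assumes [measurable]: "f \<in> borel_measurable borel" "f' \<in> borel_measurable borel" "k \<in> borel_measurable borel"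
  shows "nconv (\<lambda>s. f s + c * f' s) k t = nconv f k t + c * nconv f' k t"
  unfolding nconv_def by (simp add: distrib_right nn_integral_add nn_integral_cmult mult.assoc)

lemma nconv_add_right:
  assumes [measurable]: "f \<in> borel_measurable borel" "k' \<in> borel_measurable borel" "k \<in> borel_measurable borel"
  shows "nconv f (\<lambda>s. k s + c * k' s) t = nconv f k t + c * nconv f k' t"
  unfolding nconv_def by (simp add: distrib_left nn_integral_add nn_integral_cmult mult.left_commute)

lemma nconv_mono:
  assumes "\<And>s. f s \<le> f' s" "\<And>s. k s \<le> k' s"
  shows "nconv f k t \<le> nconv f' k' t"
  unfolding nconv_def by (intro nn_integral_mono mult_mono assms) auto

lemma nconv_riesz:
  assumes "0 < a" "0 < b"
  shows "nconv (\<lambda>s. ennreal (riesz a s)) (\<lambda>s. ennreal (riesz b s)) t = ennreal (riesz (a + b) t)"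
proof -
  have "nconv (\<lambda>s. ennreal (riesz a s)) (\<lambda>s. ennreal (riesz b s)) t
      = (\<integral>\<^sup>+ s. ennreal (riesz a (t - s) * riesz b s) \<partial>lborel)"
    unfolding nconv_def using assms by (simp add: ennreal_mult riesz_nonneg)
  also have "\<dots> = ennreal (riesz (a + b) t)"
    using has_bochner_integral_riesz[OF assms, of t] assms
    by (subst nn_integral_eq_integral) (auto simp: has_bochner_integral_iff riesz_nonneg)
  finally show ?thesis .
qed

text \<open>\<open>riesz 1\<close> is the indicator of the open half-line, so the bound reduces to
  the semigroup law with exponents \<open>b\<close> and \<open>1\<close>.\<close>

lemma nconv_riesz_bounded:
  assumes b: "0 < b" and "\<And>s. s < 0 \<Longrightarrow> x s = 0" and "\<And>s. s \<le> t \<Longrightarrow> x s \<le> m"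
  shows "nconv (\<lambda>s. ennreal (riesz b s)) x t \<le> m * ennreal (riesz (b + 1) t)"
proof -
  have "nconv (\<lambda>s. ennreal (riesz b s)) x t \<le> (\<integral>\<^sup>+ s. m * (ennreal (riesz b (t - s)) * ennreal (riesz 1 s)) \<partial>lborel)"
    unfolding nconv_def
  proof (rule nn_integral_mono_AE)
    have "AE s in lborel. s \<noteq> (0::real)" by (rule AE_lborel_singleton)
    then show "AE s in lborel. ennreal (riesz b (t - s)) * x s \<le> m * (ennreal (riesz b (t - s)) * ennreal (riesz 1 s))"
    proof eventually_elim
      case (elim s)
      consider "s < 0" | "t < s" | "0 < s" "s \<le> t" using elim by linarith
      then show ?case
      proof cases
        case 3
        then have "riesz 1 s = 1" by (simp add: riesz_def)
        then show ?thesis using 3 assms(3)[of s] by (simp add: mult.commute mult_right_mono)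
      qed (auto simp: assms)
    qed
  qed
  also have "\<dots> = m * nconv (\<lambda>s. ennreal (riesz b s)) (\<lambda>s. ennreal (riesz 1 s)) t"
    unfolding nconv_def by (subst nn_integral_cmult) auto
  finally show ?thesis using b by (simp add: nconv_riesz)
qed

text \<open>Positivity of the resolvent allows the equation to be read in \<open>ennreal\<close>,
  with the subtracted term moved to the other side.\<close>

lemma resolvent_nconv:
  assumes b: "0 < b" "b < 1" and l: "0 < l"
  shows "ennreal (riesz b t) = ennreal (resolvent b l t)
    + ennreal l * nconv (\<lambda>s. ennreal (riesz b s)) (\<lambda>s. ennreal (resolvent b l s)) t"
proof -
  let ?I = "LINT s|lborel. riesz b (t - s) * resolvent b l s"
  have nn: "0 \<le> riesz b (t - s) * resolvent b l s" for s
    using assms by (intro mult_nonneg_nonneg riesz_nonneg resolvent_nonneg)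
  have "nconv (\<lambda>s. ennreal (riesz b s)) (\<lambda>s. ennreal (resolvent b l s)) t
      = (\<integral>\<^sup>+ s. ennreal (riesz b (t - s) * resolvent b l s) \<partial>lborel)"
    unfolding nconv_def using assms by (simp add: ennreal_mult riesz_nonneg resolvent_nonneg)
  also have "\<dots> = ennreal ?I"
    by (intro nn_integral_eq_integral resolvent_equation b AE_I2 nn)
  finally have "nconv (\<lambda>s. ennreal (riesz b s)) (\<lambda>s. ennreal (resolvent b l s)) t = ennreal ?I" .
  moreover have "0 \<le> ?I" using nn by (intro integral_nonneg_AE AE_I2)
  moreover have "riesz b t = resolvent b l t + l * ?I"
    using resolvent_equation(2)[OF b, of l t] by simp
  ultimately show ?thesis
    using l resolvent_nonneg[OF b l, of t] by (simp add: ennreal_mult[symmetric] ennreal_plus[symmetric] del: ennreal_plus)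
qed

text \<open>Write \<open>R\<close>, \<open>K\<close> for the two resolvents and \<open>P\<close> for
  their convolution. Convolving the equation of each with the other expresses \<open>g * R\<close>
  and \<open>g * K\<close> through \<open>P\<close> and \<open>g * P\<close>. Substituted back, the
  terms in \<open>g * P\<close> have the same factor \<open>l * (l + c)\<close> and cancel.\<close>

lemma resolvent_identity:
  assumes b: "0 < b" "b < 1" and l: "0 < l" and c: "0 < c"
  shows "ennreal (resolvent b l t) = ennreal (resolvent b (l + c) t)
    + ennreal c * nconv (\<lambda>s. ennreal (resolvent b l s)) (\<lambda>s. ennreal (resolvent b (l + c) s)) t"
proof -
  let ?g = "\<lambda>s. ennreal (riesz b s)" and ?R = "\<lambda>s. ennreal (resolvent b l s)"
    and ?K = "\<lambda>s. ennreal (resolvent b (l + c) s)"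
  let ?P = "nconv ?R ?K"
  have lc: "0 < l + c" using l c by simp
  have Rg: "?R s \<le> ?g s" and Kg: "?K s \<le> ?g s" for s
    using resolvent_le_riesz[OF b] l c by (auto intro!: ennreal_leI)
  have gR: "nconv ?g ?R t = ?P t + ennreal (l + c) * nconv ?g ?P t"
  proof -
    have "nconv ?g ?R t = nconv (\<lambda>s. ?K s + ennreal (l + c) * nconv ?g ?K s) ?R t"
      by (intro arg_cong[where f = "\<lambda>f. nconv f ?R t"] ext resolvent_nconv b lc)
    also have "\<dots> = nconv ?K ?R t + ennreal (l + c) * nconv ?g (nconv ?K ?R) t"
      by (subst nconv_add_left) (auto simp: nconv_assoc)
    also have "nconv ?K ?R = ?P" by (intro ext nconv_commute) auto
    finally show ?thesis .
  qed
  have gK: "nconv ?g ?K t = ?P t + ennreal l * nconv ?g ?P t"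
  proof -
    have "nconv ?g ?K t = nconv (\<lambda>s. ?R s + ennreal l * nconv ?g ?R s) ?K t"
      by (intro arg_cong[where f = "\<lambda>f. nconv f ?K t"] ext resolvent_nconv b l)
    also have "\<dots> = ?P t + ennreal l * nconv ?g ?P t"
      by (subst nconv_add_left) (auto simp: nconv_assoc)
    finally show ?thesis .
  qed
  \<comment> \<open>Both \<open>P\<close> and \<open>g * P\<close> are finite by domination with
    Riesz kernels, so the final elimination can be done in the reals, where subtraction is
    available.\<close>
  have P: "?P s \<le> ennreal (riesz (b + b) s)" for s
    using nconv_mono[of ?R ?g ?K ?g s, OF Rg Kg] b by (simp add: nconv_riesz)
  then have "?P t < \<infinity>" by (rule le_less_trans) simp
  then obtain p where p: "?P t = ennreal p" "0 \<le> p" by (cases "?P t") auto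
  have "nconv ?g ?P t \<le> ennreal (riesz (b + (b + b)) t)"
    using nconv_mono[of ?g ?g ?P "\<lambda>s. ennreal (riesz (b + b) s)" t, OF order_refl P] b by (simp add: nconv_riesz)
  then have "nconv ?g ?P t < \<infinity>" by (rule le_less_trans) simp
  then obtain q where q: "nconv ?g ?P t = ennreal q" "0 \<le> q" by (cases "nconv ?g ?P t") auto
  have nn: "0 \<le> resolvent b (l + c) t" "0 \<le> resolvent b l t" "0 \<le> riesz b t"
    using b l lc by (auto intro!: resolvent_nonneg riesz_nonneg)
  have "ennreal (riesz b t) = ennreal (resolvent b (l + c) t + (l + c) * (p + l * q))"
    using resolvent_nconv[OF b lc, of t] gK p q nn l c
    by (simp add: ennreal_mult[symmetric] ennreal_plus[symmetric] del: ennreal_plus)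
  then have 1: "riesz b t = resolvent b (l + c) t + (l + c) * (p + l * q)"
    using nn p q l c by (subst (asm) ennreal_inj) auto
  have "ennreal (riesz b t) = ennreal (resolvent b l t + l * (p + (l + c) * q))"
    using resolvent_nconv[OF b l, of t] gR p q nn l c
    by (simp add: ennreal_mult[symmetric] ennreal_plus[symmetric] del: ennreal_plus)
  then have 2: "riesz b t = resolvent b l t + l * (p + (l + c) * q)"
    using nn p q l c by (subst (asm) ennreal_inj) auto
  have "resolvent b l t = resolvent b (l + c) t + c * p"
    using 1 2 by (simp add: algebra_simps)
  then show ?thesis
    using p c nn by (simp add: ennreal_mult[symmetric] ennreal_plus[symmetric] del: ennreal_plus)
qed

text \<open>As \<open>riesz b\<close> decreases, \<open>riesz b t\<close> times the mass of the
  resolvent on \<open>[0, t]\<close> is at most their convolution at \<open>t\<close>, and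
  \<open>l\<close> times that is at most \<open>riesz b t\<close> by the resolvent equation.
  Dividing by \<open>l * riesz b t\<close> gives a bound uniform in \<open>t\<close>.\<close>

lemma resolvent_mass_le:
  assumes b: "0 < b" "b < 1" and l: "0 < l"
  shows "nconv (\<lambda>s. ennreal (resolvent b l s)) (indicator {0..}) t \<le> ennreal (1 / l)"
proof (cases "0 < t")
  case True
  let ?g = "\<lambda>s. ennreal (riesz b s)" and ?K = "\<lambda>s. ennreal (resolvent b l s)"
  have g: "0 < riesz b t" using True b by (intro riesz_pos)
  have "?g t * nconv ?K (indicator {0..}) t = (\<integral>\<^sup>+ s. ?g t * (?K (t - s) * indicator {0..} s) \<partial>lborel)"
    unfolding nconv_def by (subst nn_integral_cmult) auto
  also have "\<dots> \<le> nconv ?K ?g t"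
    unfolding nconv_def
  proof (rule nn_integral_mono_AE)
    have "AE s in lborel. s \<noteq> (0::real)" by (rule AE_lborel_singleton)
    then show "AE s in lborel. ?g t * (?K (t - s) * indicator {0..} s) \<le> ?K (t - s) * ?g s"
    proof eventually_elim
      case (elim s)
      consider "s < 0" | "t < s" | "0 < s" "s \<le> t" using elim by linarith
      then show ?case
      proof cases
        case 3
        then show ?thesis using b riesz_antimono[of b s t]
          by (auto simp: mult.commute intro!: mult_right_mono ennreal_leI)
      qed auto
    qed
  qed
  also have "nconv ?K ?g t = nconv ?g ?K t" by (intro nconv_commute) auto
  finally have "ennreal l * (?g t * nconv ?K (indicator {0..}) t) \<le> ennreal l * nconv ?g ?K t"
    by (intro mult_left_mono) auto
  also have "\<dots> \<le> ?g t"
    by (subst (2) resolvent_nconv[OF b l]) simp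
  finally have "(ennreal (l * riesz b t)) * nconv ?K (indicator {0..}) t \<le> (ennreal (l * riesz b t)) * ennreal (1 / l)"
    using l g by (simp add: ennreal_mult[symmetric] mult.assoc[symmetric])
  then show ?thesis
    using l g by (subst (asm) ennreal_mult_le_mult_iff) (auto simp: ennreal_mult_eq_top_iff)
next
  case False
  then have "(\<lambda>s. ennreal (resolvent b l (t - s)) * indicator {0..} s) = (\<lambda>s. 0)"
    by (auto split: split_indicator)
  then show ?thesis by (simp add: nconv_def)
qed

text \<open>Let \<open>R\<close>, \<open>K\<close> be the resolvents for \<open>l\<close> and
  \<open>l + c\<close>, and \<open>P\<close> their convolution. Convolving the hypothesis with
  \<open>R\<close> gives \<open>R * x \<le> R * y + c * (P * x)\<close>, while the resolvent
  identity gives \<open>R * x = K * x + c * (P * x)\<close>. Cancelling leaves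
  \<open>K * x \<le> R * y\<close>; the local bound on \<open>x\<close> makes the cancelled term
  finite.\<close>

lemma volterra_comparison:
  assumes b: "0 < b" "b < 1" and l: "0 < l" and c: "0 < c"
    and [measurable]: "x \<in> borel_measurable borel" "y \<in> borel_measurable borel"
    and x0: "\<And>s. s < 0 \<Longrightarrow> x s = 0" and xm: "\<And>s. s \<le> t \<Longrightarrow> x s \<le> ennreal m"
    and le: "\<And>s. x s \<le> y s + ennreal c * nconv (\<lambda>s. ennreal (resolvent b (l + c) s)) x s"
  shows "x t \<le> y t + ennreal c * nconv (\<lambda>s. ennreal (resolvent b l s)) y t"
proof -
  let ?g = "\<lambda>s. ennreal (riesz b s)" and ?R = "\<lambda>s. ennreal (resolvent b l s)"
    and ?K = "\<lambda>s. ennreal (resolvent b (l + c) s)"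
  let ?P = "nconv ?R ?K"
  have R: "?R s = ?K s + ennreal c * ?P s" for s
    by (intro resolvent_identity b l c)
  have Rg: "?R s \<le> ?g s" for s
    using resolvent_le_riesz[OF b l] by (intro ennreal_leI)
  have eq: "nconv ?R x t = nconv ?K x t + ennreal c * nconv ?P x t"
  proof -
    have "nconv ?R x t = nconv (\<lambda>s. ?K s + ennreal c * ?P s) x t"
      by (intro arg_cong[where f = "\<lambda>f. nconv f x t"] ext R)
    then show ?thesis by (simp add: nconv_add_left)
  qed
  have "nconv ?R x t \<le> nconv ?g x t"
    by (intro nconv_mono Rg order_refl)
  also have "\<dots> \<le> ennreal m * ennreal (riesz (b + 1) t)"
    using b x0 xm by (intro nconv_riesz_bounded) auto
  also have "\<dots> < \<infinity>" by (simp add: ennreal_mult_less_top)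
  finally have fin: "ennreal c * nconv ?P x t \<noteq> \<infinity>"
    unfolding eq by (auto simp: less_top[symmetric])
  have "nconv ?R x t \<le> nconv ?R (\<lambda>s. y s + ennreal c * nconv ?K x s) t"
    by (intro nconv_mono le order_refl)
  also have "\<dots> = nconv ?R y t + ennreal c * nconv ?P x t"
    by (subst nconv_add_right) (auto simp: nconv_assoc)
  finally have "ennreal c * nconv ?P x t + nconv ?K x t \<le> ennreal c * nconv ?P x t + nconv ?R y t"
    unfolding eq by (simp add: add.commute)
  then have "nconv ?K x t \<le> nconv ?R y t"
    using fin by (subst (asm) ennreal_add_left_cancel_le) auto
  then have "y t + ennreal c * nconv ?K x t \<le> y t + ennreal c * nconv ?R y t"
    by (intro add_left_mono mult_left_mono) auto
  with le[of t] show ?thesis by (rule order_trans)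
qed

section \<open>Decay at infinity\<close>

lemma tendsto_riesz_at_top:
  assumes "0 < b" "b < 1"
  shows "(riesz b \<longlongrightarrow> 0) at_top"
proof -
  have "((\<lambda>t. t powr (b - 1) / Gamma b) \<longlongrightarrow> 0 / Gamma b) at_top"
    using assms less_imp_neq[OF Gamma_real_pos[of b]]
    by (intro tendsto_divide tendsto_const tendsto_neg_powr filterlim_ident) auto
  moreover have "eventually (\<lambda>t. t powr (b - 1) / Gamma b = riesz b t) at_top"
    using eventually_gt_at_top[of 0] by eventually_elim (simp add: riesz_def)
  ultimately show ?thesis
    using Lim_transform_eventually by fastforce
qed

text \<open>Split at a time \<open>T\<close> after which \<open>y\<close> is small. The part before
  \<open>T\<close> is at most \<open>riesz b (t - T)\<close> times a finite integral of
  \<open>y\<close>; the part after \<open>T\<close> is controlled by the uniform mass bound.\<close>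

lemma nconv_resolvent_tendsto_0:
  assumes b: "0 < b" "b < 1" and l: "0 < l"
    and [measurable]: "y \<in> borel_measurable borel"
    and y0: "\<And>s. s < 0 \<Longrightarrow> y s = 0"
    and int: "\<And>T. 0 < T \<Longrightarrow> (\<integral>\<^sup>+ s\<in>{0..T}. y s \<partial>lborel) < \<infinity>"
    and lim: "(y \<longlongrightarrow> 0) at_top"
  shows "(nconv (\<lambda>s. ennreal (resolvent b l s)) y \<longlongrightarrow> 0) at_top"
proof (rule order_tendstoI)
  let ?R = "\<lambda>s. ennreal (resolvent b l s)"
  fix e :: ennreal assume "0 < e"
  \<comment> \<open>\<open>e\<close> may be infinite, so a positive real below it is used
    instead.\<close>
  then obtain e' where "0 < e'" "e' < e" using dense by blast
  then obtain r where r: "e' = ennreal r" "0 < r"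
    by (cases e') (auto simp: ennreal_less_zero_iff)
  \<comment> \<open>Chosen so that \<open>d\<close> times the mass bound \<open>1 / l\<close> equals
    \<open>r / 2\<close>.\<close>
  define d where "d = l * r / 2"
  have d: "0 < d" using l r by (simp add: d_def)
  have "eventually (\<lambda>s. y s < ennreal d) at_top"
    using lim d by (intro order_tendstoD) auto
  then obtain T0 where T0: "\<And>s. T0 \<le> s \<Longrightarrow> y s < ennreal d"
    by (auto simp: eventually_at_top_linorder)
  define T where "T = max T0 1"
  have T: "0 < T" "\<And>s. T \<le> s \<Longrightarrow> y s < ennreal d" using T0 by (auto simp: T_def)
  obtain i where i: "(\<integral>\<^sup>+ s\<in>{0..T}. y s \<partial>lborel) = ennreal i" "0 \<le> i"
    using int[OF T(1)] by (cases "\<integral>\<^sup>+ s\<in>{0..T}. y s \<partial>lborel") auto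
  have "((\<lambda>t. riesz b (- T + t) * i) \<longlongrightarrow> 0 * i) at_top"
    by (intro tendsto_intros filterlim_compose[OF tendsto_riesz_at_top[OF b]] filterlim_tendsto_add_at_top[OF tendsto_const] filterlim_ident)
  then have "eventually (\<lambda>t. riesz b (- T + t) * i < r / 2) at_top"
    using r by (intro order_tendstoD) auto
  then show "eventually (\<lambda>t. nconv ?R y t < e) at_top"
    using eventually_gt_at_top[of T]
  proof eventually_elim
    case (elim t)
    have "nconv ?R y t \<le> (\<integral>\<^sup>+ s. ennreal (riesz b (t - T)) * (y s * indicator {0..T} s)
        + ennreal d * (?R (t - s) * indicator {0..} s) \<partial>lborel)"
      unfolding nconv_def
    proof (intro nn_integral_mono)
      fix s
      consider "s < 0" | "0 \<le> s" "s \<le> T" | "T < s" by linarith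
      then show "?R (t - s) * y s \<le> ennreal (riesz b (t - T)) * (y s * indicator {0..T} s)
        + ennreal d * (?R (t - s) * indicator {0..} s)"
      proof cases
        case 2
        have "resolvent b l (t - s) \<le> riesz b (t - s)"
          by (intro resolvent_le_riesz b l)
        also have "\<dots> \<le> riesz b (t - T)"
          using 2 elim b by (intro riesz_antimono) auto
        finally have "?R (t - s) * y s \<le> ennreal (riesz b (t - T)) * y s"
          by (intro mult_right_mono ennreal_leI) auto
        then show ?thesis using 2 by (simp add: add_increasing2)
      next
        case 3
        have "?R (t - s) * y s \<le> ennreal d * ?R (t - s)"
          using T(2)[of s] 3 by (subst mult.commute) (intro mult_right_mono, auto)
        then show ?thesis using 3 T(1) by (simp add: add_increasing)
      qed (auto simp: y0)
    qed
    also have "\<dots> = ennreal (riesz b (t - T)) * ennreal i + ennreal d * nconv ?R (indicator {0..}) t"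
      unfolding nconv_def i(1)[symmetric] by (simp add: nn_integral_add nn_integral_cmult)
    also have "\<dots> \<le> ennreal (riesz b (t - T)) * ennreal i + ennreal d * ennreal (1 / l)"
      by (intro add_left_mono mult_left_mono resolvent_mass_le b l) auto
    also have "\<dots> = ennreal (riesz b (t - T) * i + r / 2)"
      using i r l b by (simp add: d_def ennreal_mult[symmetric] ennreal_plus[symmetric] riesz_nonneg del: ennreal_plus)
    also have "\<dots> \<le> ennreal r"
      using elim by (intro ennreal_leI) auto
    also have "\<dots> < e" using r \<open>e' < e\<close> by simp
    finally show ?case .
  qed
qed simp

section \<open>Pathwise convolution\<close>

definition rconv :: "(real \<Rightarrow> real) \<Rightarrow> (real \<Rightarrow> real) \<Rightarrow> real \<Rightarrow> real" where
  "rconv k w t = (LINT s|lborel. k (t - s) * w s)"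

text \<open>Because \<open>w\<close> vanishes at negative times, local boundedness can be stated on
  the whole half-line below \<open>T\<close>.\<close>

definition causal_bounded :: "(real \<Rightarrow> real) \<Rightarrow> bool" where
  "causal_bounded w \<longleftrightarrow> w \<in> borel_measurable borel \<and> (\<forall>s<0. w s = 0)
     \<and> (\<forall>T. \<exists>m\<ge>0. \<forall>s\<le>T. \<bar>w s\<bar> \<le> m)"

text \<open>Treats \<open>riesz b\<close> and its resolvents together. The two inequalities also
  force \<open>k\<close> to vanish on nonpositive arguments.\<close>

definition dominated_kernel :: "real \<Rightarrow> (real \<Rightarrow> real) \<Rightarrow> bool" where
  "dominated_kernel b k \<longleftrightarrow> k \<in> borel_measurable borel \<and> (\<forall>t. 0 \<le> k t \<and> k t \<le> riesz b t)"

lemma dominated_kernel_riesz: "0 < b \<Longrightarrow> dominated_kernel b (riesz b)"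
  by (simp add: dominated_kernel_def riesz_nonneg)

lemma dominated_kernel_resolvent:
  "0 < b \<Longrightarrow> b < 1 \<Longrightarrow> 0 < l \<Longrightarrow> dominated_kernel b (resolvent b l)"
  by (simp add: dominated_kernel_def resolvent_nonneg resolvent_le_riesz)

section \<open>Integrability, bounds and linearity of the pathwise convolution\<close>

lemma borel_measurable_rconv:
  assumes [measurable]: "k \<in> borel_measurable borel" "w \<in> borel_measurable borel"
  shows "rconv k w \<in> borel_measurable borel"
  unfolding rconv_def[abs_def] by measurable

lemma rconv_integrand_bound:
  assumes k: "dominated_kernel b k" and w: "causal_bounded w" and m: "\<And>s. s \<le> t \<Longrightarrow> \<bar>w s\<bar> \<le> m"
  shows "AE s in lborel. norm (k (t - s) * w s) \<le> m * (riesz b (t - s) * riesz 1 s)"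
proof -
  have "AE s in lborel. s \<noteq> (0::real)" by (rule AE_lborel_singleton)
  then show ?thesis
  proof eventually_elim
    case (elim s)
    have k': "0 \<le> k (t - s)" "k (t - s) \<le> riesz b (t - s)"
      using k by (auto simp: dominated_kernel_def)
    consider "s < 0" | "t < s" | "0 < s" "s \<le> t" using elim by linarith
    then show ?case
    proof cases
      case 1
      then show ?thesis using w by (simp add: causal_bounded_def)
    next
      case 2
      then show ?thesis using k' by simp
    next
      case 3
      have "k (t - s) * \<bar>w s\<bar> \<le> riesz b (t - s) * m"
        using 3 k' m[of s] by (intro mult_mono) auto
      moreover have "riesz 1 s = 1" using 3 by (simp add: riesz_def)
      ultimately show ?thesis using k' by (simp add: abs_mult mult.commute)
    qed
  qed
qed

lemma integrable_rconv:
  assumes b: "0 < b" and k: "dominated_kernel b k" and w: "causal_bounded w"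
  shows "integrable lborel (\<lambda>s. k (t - s) * w s)"
proof -
  have [measurable]: "k \<in> borel_measurable borel" "w \<in> borel_measurable borel"
    using k w by (auto simp: dominated_kernel_def causal_bounded_def)
  obtain m where m: "\<And>s. s \<le> t \<Longrightarrow> \<bar>w s\<bar> \<le> m"
    using w unfolding causal_bounded_def by blast
  have "integrable lborel (\<lambda>s. m * (riesz b (t - s) * riesz 1 s))"
    using b by (intro integrable_mult_right integrable_riesz) auto
  then show ?thesis
  proof (rule Bochner_Integration.integrable_bound)
    show "AE s in lborel. norm (k (t - s) * w s) \<le> norm (m * (riesz b (t - s) * riesz 1 s))"
      using rconv_integrand_bound[OF k w, of t m, OF m]
      by (auto elim!: eventually_mono intro: order_trans[OF _ abs_ge_self])
  qed measurable
qed

lemma rconv_bound: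
  assumes b: "0 < b" and k: "dominated_kernel b k" and w: "causal_bounded w"
    and m: "\<And>s. s \<le> t \<Longrightarrow> \<bar>w s\<bar> \<le> m"
  shows "\<bar>rconv k w t\<bar> \<le> m * riesz (b + 1) t"
proof -
  have "\<bar>rconv k w t\<bar> \<le> (LINT s|lborel. norm (k (t - s) * w s))"
    unfolding rconv_def real_norm_def[symmetric] by (rule integral_norm_bound)
  also have "\<dots> \<le> (LINT s|lborel. m * (riesz b (t - s) * riesz 1 s))"
    using b by (intro integral_mono_AE integrable_norm integrable_rconv[OF b k w] integrable_mult_right
        integrable_riesz rconv_integrand_bound[OF k w m]) auto
  also have "\<dots> = m * riesz (b + 1) t"
    using b by (simp add: integral_riesz)
  finally show ?thesis .
qed

lemma causal_bounded_rconv: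
  assumes b: "0 < b" and k: "dominated_kernel b k" and w: "causal_bounded w"
  shows "causal_bounded (rconv k w)"
  unfolding causal_bounded_def
proof (intro conjI allI impI)
  show "rconv k w \<in> borel_measurable borel"
    using k w by (intro borel_measurable_rconv) (auto simp: dominated_kernel_def causal_bounded_def)
next
  fix t :: real assume "t < 0"
  then have "\<bar>w s\<bar> \<le> 0" if "s \<le> t" for s
    using w that by (simp add: causal_bounded_def)
  from rconv_bound[OF b k w, of t 0, OF this] show "rconv k w t = 0" by simp
next
  fix T
  obtain m where m: "0 \<le> m" "\<And>s. s \<le> T \<Longrightarrow> \<bar>w s\<bar> \<le> m"
    using w unfolding causal_bounded_def by blast
  have "\<bar>rconv k w t\<bar> \<le> m * riesz (b + 1) T" if "t \<le> T" for t
  proof -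
    have "\<bar>rconv k w t\<bar> \<le> m * riesz (b + 1) t"
      using that by (intro rconv_bound[OF b k w] m) auto
    also have "\<dots> \<le> m * riesz (b + 1) T"
      using b m that by (intro mult_left_mono riesz_mono) auto
    finally show ?thesis .
  qed
  then show "\<exists>M\<ge>0. \<forall>s\<le>T. \<bar>rconv k w s\<bar> \<le> M"
    using m b by (intro exI[of _ "m * riesz (b + 1) T"]) (auto intro!: mult_nonneg_nonneg riesz_nonneg)
qed

lemma causal_bounded_max:
  assumes "causal_bounded w"
  shows "causal_bounded (\<lambda>s. max 0 (w s))"
  using assms unfolding causal_bounded_def by (auto simp: abs_le_iff max_def) (meson order_trans)

lemma causal_bounded_uminus: "causal_bounded w \<Longrightarrow> causal_bounded (\<lambda>s. - w s)"
  unfolding causal_bounded_def by auto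

lemma rconv_diff:
  assumes "0 < b" "dominated_kernel b k" "causal_bounded v" "causal_bounded w"
  shows "rconv k (\<lambda>s. v s - w s) t = rconv k v t - rconv k w t"
  unfolding rconv_def right_diff_distrib
  using assms by (intro Bochner_Integration.integral_diff integrable_rconv)

lemma rconv_add:
  assumes "0 < b" "dominated_kernel b k" "causal_bounded v" "causal_bounded w"
  shows "rconv k (\<lambda>s. v s + w s) t = rconv k v t + rconv k w t"
  unfolding rconv_def distrib_left
  using assms by (intro Bochner_Integration.integral_add integrable_rconv)

lemma rconv_cmult: "rconv k (\<lambda>s. c * w s) t = c * rconv k w t"
  unfolding rconv_def by (simp add: mult.left_commute)

lemma nconv_eq_rconv:
  assumes b: "0 < b" and k: "dominated_kernel b k" and w: "causal_bounded w" and nn: "\<And>s. 0 \<le> w s"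
  shows "nconv (\<lambda>s. ennreal (k s)) (\<lambda>s. ennreal (w s)) t = ennreal (rconv k w t)" "0 \<le> rconv k w t"
proof -
  have k0: "0 \<le> k s" for s using k by (simp add: dominated_kernel_def)
  have "nconv (\<lambda>s. ennreal (k s)) (\<lambda>s. ennreal (w s)) t = (\<integral>\<^sup>+ s. ennreal (k (t - s) * w s) \<partial>lborel)"
    unfolding nconv_def using k0 nn by (simp add: ennreal_mult)
  also have "\<dots> = ennreal (rconv k w t)"
    unfolding rconv_def using k0 nn by (intro nn_integral_eq_integral integrable_rconv[OF b k w]) auto
  finally show "nconv (\<lambda>s. ennreal (k s)) (\<lambda>s. ennreal (w s)) t = ennreal (rconv k w t)" .
  show "0 \<le> rconv k w t"
    unfolding rconv_def using k0 nn by (intro integral_nonneg_AE) auto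
qed

text \<open>This is the resolvent equation convolved with \<open>w\<close>. For nonnegative
  \<open>w\<close> it follows from associativity of \<open>nconv\<close>; the general case is linear
  in the positive and negative parts of \<open>w\<close>.\<close>

lemma rconv_resolvent:
  assumes b: "0 < b" "b < 1" and l: "0 < l" and w: "causal_bounded w"
  shows "rconv (resolvent b l) w t = rconv (riesz b) w t - l * rconv (riesz b) (rconv (resolvent b l) w) t"
proof -
  let ?g = "riesz b" and ?K = "resolvent b l"
  note g = dominated_kernel_riesz[OF b(1)] and K = dominated_kernel_resolvent[OF b l]
  have nonneg: "rconv ?K w t = rconv ?g w t - l * rconv ?g (rconv ?K w) t"
    if w: "causal_bounded w" and nn: "\<And>s. 0 \<le> w s" for w
  proof -
    have [measurable]: "w \<in> borel_measurable borel" using w by (simp add: causal_bounded_def)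
    note Kw = causal_bounded_rconv[OF b(1) K w]
    note eqK = nconv_eq_rconv[OF b(1) K w nn] and eqg = nconv_eq_rconv[OF b(1) g w nn]
      and eqgK = nconv_eq_rconv[OF b(1) g Kw nconv_eq_rconv(2)[OF b(1) K w nn]]
    have "nconv ?g w t = nconv (\<lambda>s. ennreal (?K s) + ennreal l * nconv ?g ?K s) w t"
      by (intro arg_cong[where f = "\<lambda>f. nconv f w t"] ext resolvent_nconv b l)
    also have "\<dots> = nconv ?K w t + ennreal l * nconv ?g (nconv ?K w) t"
      by (subst nconv_add_left) (auto simp: nconv_assoc)
    also have "nconv ?K w = (\<lambda>s. ennreal (rconv ?K w s))"
      by (intro ext eqK(1))
    finally have "ennreal (rconv ?g w t) = ennreal (rconv ?K w t) + ennreal l * ennreal (rconv ?g (rconv ?K w) t)"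
      by (simp add: eqK(1) eqg(1) eqgK(1))
    then have "ennreal (rconv ?g w t) = ennreal (rconv ?K w t + l * rconv ?g (rconv ?K w) t)"
      using eqK(2) eqgK(2) l by (simp add: ennreal_mult[symmetric] ennreal_plus[symmetric] del: ennreal_plus)
    then have "rconv ?g w t = rconv ?K w t + l * rconv ?g (rconv ?K w) t"
      using eqK(2) eqg(2) eqgK(2) l by (subst (asm) ennreal_inj) auto
    then show ?thesis by simp
  qed
  define p where "p s = max 0 (w s)" for s
  define n where "n s = max 0 (- w s)" for s
  have pn: "causal_bounded p" "causal_bounded n"
    unfolding p_def n_def by (intro causal_bounded_max causal_bounded_uminus w)+
  have w_eq: "w = (\<lambda>s. p s - n s)" by (auto simp: p_def n_def max_def)
  have "rconv ?K w = (\<lambda>s. rconv ?K p s - rconv ?K n s)"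
    unfolding w_eq by (intro ext rconv_diff[OF b(1) K] pn)
  then have 1: "rconv ?g (rconv ?K w) t = rconv ?g (rconv ?K p) t - rconv ?g (rconv ?K n) t"
    by (simp add: rconv_diff[OF b(1) g] causal_bounded_rconv[OF b(1) K] pn)
  have "rconv ?K w t = rconv ?K p t - rconv ?K n t" "rconv ?g w t = rconv ?g p t - rconv ?g n t"
    unfolding w_eq by (intro rconv_diff[OF b(1)] K g pn)+
  then show ?thesis
    using nonneg[OF pn(1)] nonneg[OF pn(2)] unfolding 1 by (simp add: p_def n_def algebra_simps)
qed

text \<open>A Hoelder modulus of exponent \<open>b\<close>. The change of the kernel on
  \<open>[0, t]\<close> and its new mass on \<open>[t, t']\<close> each contribute at most
  \<open>m * riesz (b + 1) (t' - t)\<close>.\<close>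

lemma rconv_riesz_modulus:
  assumes b: "0 < b" "b < 1" and w: "causal_bounded w" and t: "0 \<le> t" "t \<le> t'"
    and m: "\<And>s. s \<le> t' \<Longrightarrow> \<bar>w s\<bar> \<le> m"
  shows "\<bar>rconv (riesz b) w t' - rconv (riesz b) w t\<bar> \<le> 2 * m * riesz (b + 1) (t' - t)"
proof -
  let ?g = "riesz b"
  note g = dominated_kernel_riesz[OF b(1)]
  have m0: "0 \<le> m" using m[of t'] by auto
  \<comment> \<open>The factor \<open>2\<close> corrects the sign beyond \<open>t\<close>: there the
    first product vanishes, and \<open>- riesz b (t' - s)\<close> becomes
    \<open>+ riesz b (t' - s)\<close>.\<close>
  let ?B = "\<lambda>s. m * (?g (t - s) * riesz 1 s - ?g (t' - s) * riesz 1 s + 2 * (?g (t' - s) * riesz 1 (s - t)))"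
  have sh: "has_bochner_integral lborel (\<lambda>s. ?g (t' - s) * riesz 1 (s - t)) (riesz (b + 1) (t' - t))"
    using has_bochner_integral_riesz[OF b(1) zero_less_one, of "t' - t"]
    by (subst lborel_has_bochner_integral_real_affine_iff[of 1 _ _ t]) (auto simp: algebra_simps)
  have B: "has_bochner_integral lborel ?B (m * (riesz (b + 1) t - riesz (b + 1) t' + 2 * riesz (b + 1) (t' - t)))"
    using b by (intro has_bochner_integral_mult_right has_bochner_integral_add has_bochner_integral_diff sh
      has_bochner_integral_riesz) auto
  have int: "integrable lborel (\<lambda>s. ?g (t' - s) * w s - ?g (t - s) * w s)"
    by (intro Bochner_Integration.integrable_diff integrable_rconv[OF b(1) g w])
  have "rconv ?g w t' - rconv ?g w t = (LINT s|lborel. ?g (t' - s) * w s - ?g (t - s) * w s)"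
    unfolding rconv_def
    by (intro Bochner_Integration.integral_diff[symmetric] integrable_rconv[OF b(1) g w])
  then have "\<bar>rconv ?g w t' - rconv ?g w t\<bar> \<le> (LINT s|lborel. norm (?g (t' - s) * w s - ?g (t - s) * w s))"
    unfolding real_norm_def[symmetric] by (simp only: integral_norm_bound)
  also have "\<dots> \<le> (LINT s|lborel. ?B s)"
  proof (intro integral_mono_AE integrable_norm int)
    show "integrable lborel ?B" using B by (rule integrable.intros)
    have "AE s in lborel. s \<noteq> (0::real)" "AE s in lborel. s \<noteq> t" by (rule AE_lborel_singleton)+
    then show "AE s in lborel. norm (?g (t' - s) * w s - ?g (t - s) * w s) \<le> ?B s"
    proof eventually_elim
      case (elim s)
      have n: "norm (?g (t' - s) * w s - ?g (t - s) * w s) = \<bar>?g (t' - s) - ?g (t - s)\<bar> * \<bar>w s\<bar>"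
        by (simp add: abs_mult[symmetric] left_diff_distrib)
      consider "s < 0" | "0 < s" "s < t" | "t < s" "s \<le> t'" | "t' < s" using elim t by linarith
      then show ?case
      proof cases
        case 1
        then show ?thesis using w t by (simp add: causal_bounded_def)
      next
        case 2
        have "?g (t' - s) \<le> ?g (t - s)" using 2 t b by (intro riesz_antimono) auto
        then have "\<bar>?g (t' - s) - ?g (t - s)\<bar> * \<bar>w s\<bar> \<le> (?g (t - s) - ?g (t' - s)) * m"
          using 2 t by (intro mult_mono m) auto
        moreover have "riesz 1 s = 1" using 2 by (simp add: riesz_def)
        ultimately show ?thesis unfolding n using 2 by (simp add: mult.commute)
      next
        case 3
        have "\<bar>?g (t' - s)\<bar> * \<bar>w s\<bar> \<le> ?g (t' - s) * m"
          using 3 t riesz_nonneg[OF b(1)] by (intro mult_mono m) auto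
        moreover have "riesz 1 s = 1" "riesz 1 (s - t) = 1" using 3 t by (auto simp: riesz_def)
        ultimately show ?thesis unfolding n using 3 by (simp add: mult.commute)
      next
        case 4
        then show ?thesis using t by simp
      qed
    qed
  qed
  also have "\<dots> = m * (riesz (b + 1) t - riesz (b + 1) t' + 2 * riesz (b + 1) (t' - t))"
    using B by (rule has_bochner_integral_integral_eq)
  also have "\<dots> \<le> m * (2 * riesz (b + 1) (t' - t))"
    using riesz_mono[of "b + 1" t t'] b t m0 by (intro mult_left_mono) auto
  finally show ?thesis by (simp add: mult_ac)
qed

lemma continuous_on_rconv_riesz:
  assumes b: "0 < b" "b < 1" and w: "causal_bounded w"
  shows "continuous_on {0..} (rconv (riesz b) w)"
  unfolding continuous_on_def
proof
  fix x :: real assume x: "x \<in> {0..}"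
  obtain m where m: "\<And>s. s \<le> x + 1 \<Longrightarrow> \<bar>w s\<bar> \<le> m"
    using w unfolding causal_bounded_def by blast
  let ?F = "rconv (riesz b) w"
  have lim: "((\<lambda>t. 2 * m * (\<bar>t - x\<bar> powr b / Gamma (b + 1))) \<longlongrightarrow> 2 * m * (\<bar>x - x\<bar> powr b / Gamma (b + 1))) (at x within {0..})"
    using b less_imp_neq[OF Gamma_real_pos[of "b + 1"]]
    by (intro tendsto_intros tendsto_powr') auto
  have "eventually (\<lambda>t. t \<in> {0..x + 1}) (at x within {0..})"
    using eventually_at_topological[of "\<lambda>t. t \<in> {0..x+1}" x "{0..}"]
    by (auto intro!: exI[of _ "{..<x + 1}"])
  then have "eventually (\<lambda>t. norm (?F t - ?F x) \<le> 2 * m * (\<bar>t - x\<bar> powr b / Gamma (b + 1))) (at x within {0..})"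
  proof eventually_elim
    case (elim t)
    have r: "riesz (b + 1) d = d powr b / Gamma (b + 1)" if "0 \<le> d" for d
      using that b by (auto simp: riesz_def)
    show ?case
    proof (cases "x \<le> t")
      case True
      then show ?thesis
        using rconv_riesz_modulus[OF b w, of x t m] x elim m by (simp add: r)
    next
      case False
      then show ?thesis
        using rconv_riesz_modulus[OF b w, of t x m] x elim m by (simp add: r abs_minus_commute)
    qed
  qed
  then have "((\<lambda>t. ?F t - ?F x) \<longlongrightarrow> 0) (at x within {0..})"
    by (rule Lim_null_comparison) (use lim in simp)
  then show "(?F \<longlongrightarrow> ?F x) (at x within {0..})"
    by (simp add: LIM_zero_iff)
qed

text \<open>By \<open>rconv_resolvent\<close> the function is a combination of two convolutions with
  \<open>riesz b\<close>, for which the modulus is available.\<close>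

lemma continuous_on_rconv_resolvent:
  assumes b: "0 < b" "b < 1" and l: "0 < l" and w: "causal_bounded w"
  shows "continuous_on {0..} (rconv (resolvent b l) w)"
proof -
  have "continuous_on {0..} (\<lambda>t. rconv (riesz b) w t - l * rconv (riesz b) (rconv (resolvent b l) w) t)"
    by (intro continuous_intros continuous_on_rconv_riesz b w
        causal_bounded_rconv[OF b(1) dominated_kernel_resolvent[OF b l]])
  then show ?thesis
    by (subst continuous_on_cong[OF refl rconv_resolvent[OF b l w]])
qed

text \<open>The integrands agree even at \<open>s = t\<close>, where \<open>0 powr (b - 1)\<close>
  and \<open>riesz b 0\<close> are both \<open>0\<close>.\<close>

lemma fractional_integral_eq_rconv:
  assumes "\<And>s. 0 \<le> s \<Longrightarrow> w s = v s" "\<And>s. s < 0 \<Longrightarrow> w s = 0"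
  shows "1 / Gamma b * (LINT s:{0..t}|lborel. (t - s) powr (b - 1) * v s) = rconv (riesz b) w t"
proof -
  have "indicator {0..t} s *\<^sub>R ((t - s) powr (b - 1) * v s) / Gamma b = riesz b (t - s) * w s" for s
    using assms(1)[of s] assms(2)[of s] by (cases "s < 0"; cases "s < t") (auto simp: riesz_def split: split_indicator)
  then show ?thesis
    unfolding rconv_def set_lebesgue_integral_def by (simp flip: integral_divide_zero)
qed

section \<open>Stability in the mean\<close>

text \<open>A function that is measurable in \<open>\<omega>\<close> and continuous in \<open>s\<close> is jointly measurable, being the
  limit of its values at the grid points \<open>\<lfloor>(n + 1) * s\<rfloor> / (n + 1)\<close>.\<close>

lemma continuous_process_modification:
  assumes "continuous_process M Z"
  obtains Z' where "case_prod Z' \<in> borel_measurable (lborel \<Otimes>\<^sub>M M)"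
    and "\<And>s \<omega>. s < 0 \<Longrightarrow> Z' s \<omega> = 0"
    and "\<And>\<omega>. continuous_on {0..} (\<lambda>s. Z' s \<omega>)"
    and "AE \<omega> in M. \<forall>s\<ge>0. Z' s \<omega> = Z s \<omega>"
proof -
  have meas: "\<And>t. 0 \<le> t \<Longrightarrow> Z t \<in> borel_measurable M" and "AE \<omega> in M. continuous_on {0..} (\<lambda>t. Z t \<omega>)"
    using assms by (auto simp: continuous_process_def process_def)
  then obtain N where N: "\<And>\<omega>. \<omega> \<in> space M - N \<Longrightarrow> continuous_on {0..} (\<lambda>t. Z t \<omega>)" "N \<in> null_sets M"
    by (auto elim!: AE_E3)
  \<comment> \<open>Clearing a null set makes every path continuous on the half-line, and the zero
    extension fixes the values at negative times, where nothing is known about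
    \<open>Z\<close>.\<close>
  define Z' where "Z' s \<omega> = (if 0 \<le> s \<and> \<omega> \<in> space M - N then Z s \<omega> else 0)" for s \<omega>
  have [measurable]: "N \<in> sets M" using N by auto
  have Z'm: "Z' s \<in> borel_measurable M" for s
  proof (cases "0 \<le> s")
    case True
    note meas[OF True, measurable]
    show ?thesis using True unfolding Z'_def[abs_def] by simp measurable
  qed (simp add: Z'_def[abs_def])
  have neg: "Z' s \<omega> = 0" if "s < 0" for s \<omega> using that by (simp add: Z'_def)
  have cont: "continuous_on {0..} (\<lambda>s. Z' s \<omega>)" for \<omega>
  proof (cases "\<omega> \<in> space M - N")
    case True
    then show ?thesis
      by (intro continuous_on_eq[OF N(1)[OF True]]) (simp add: Z'_def)
  next
    case False
    then have "Z' s \<omega> = 0" for s by (auto simp: Z'_def)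
    then show ?thesis by simp
  qed
  \<comment> \<open>Rounding down respects the sign of \<open>s\<close>: for nonnegative
    \<open>s\<close> the grid points stay in the region of continuity, and for negative
    \<open>s\<close> they stay where \<open>Z'\<close> is \<open>0\<close>.\<close>
  define q where "q n s = real_of_int \<lfloor>real (Suc n) * s\<rfloor> / real (Suc n)" for n s
  have "(\<lambda>p. case_prod Z' p) \<in> borel_measurable (lborel \<Otimes>\<^sub>M M)"
  proof (rule borel_measurable_LIMSEQ_real)
    fix n
    show "(\<lambda>p. Z' (q n (fst p)) (snd p)) \<in> borel_measurable (lborel \<Otimes>\<^sub>M M)"
      unfolding q_def
    proof (rule measurable_compose_countable[where f = "\<lambda>i p. Z' (real_of_int i / real (Suc n)) (snd p)"])
      show "(\<lambda>p. Z' (real_of_int i / real (Suc n)) (snd p)) \<in> borel_measurable (lborel \<Otimes>\<^sub>M M)" for i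
        by (rule measurable_compose[OF measurable_snd Z'm])
    qed measurable
  next
    fix p :: "real \<times> 'a"
    obtain s \<omega> where p: "p = (s, \<omega>)" by (cases p)
    show "(\<lambda>n. Z' (q n (fst p)) (snd p)) \<longlonglongrightarrow> case_prod Z' p"
    proof (cases "0 \<le> s")
      case True
      have "(\<lambda>n. q n s) \<longlonglongrightarrow> s"
      proof (rule real_tendsto_sandwich[where f = "\<lambda>n. s - 1 / real (Suc n)" and h = "\<lambda>n. s"])
        show "eventually (\<lambda>n. s - 1 / real (Suc n) \<le> q n s) sequentially"
        proof (intro always_eventually allI)
          fix n
          have "real (Suc n) * s - 1 \<le> real_of_int \<lfloor>real (Suc n) * s\<rfloor>" by linarith
          then have "(real (Suc n) * s - 1) / real (Suc n) \<le> q n s"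
            unfolding q_def by (intro divide_right_mono) auto
          then show "s - 1 / real (Suc n) \<le> q n s" by (simp add: diff_divide_distrib)
        qed
        show "eventually (\<lambda>n. q n s \<le> s) sequentially"
          by (intro always_eventually allI) (simp add: q_def divide_le_eq mult.commute del: of_nat_Suc)
        show "(\<lambda>n. s - 1 / real (Suc n)) \<longlonglongrightarrow> s"
          using tendsto_diff[OF tendsto_const LIMSEQ_inverse_real_of_nat, of s] by (simp add: inverse_eq_divide)
      qed simp
      then have "(\<lambda>n. Z' (q n s) \<omega>) \<longlonglongrightarrow> Z' s \<omega>"
        by (rule continuous_on_tendsto_compose[OF cont]) (use True in \<open>auto simp: q_def intro!: divide_nonneg_nonneg\<close>)
      then show ?thesis by (simp add: p)
    next
      case False
      then have "q n s < 0" for n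
        unfolding q_def by (intro divide_neg_pos) (auto simp: mult_less_0_iff simp del: of_nat_Suc)
      then show ?thesis using False by (simp add: p neg)
    qed
  qed
  moreover have "AE \<omega> in M. \<forall>s\<ge>0. Z' s \<omega> = Z s \<omega>"
    using AE_not_in[OF N(2)] AE_space by eventually_elim (simp add: Z'_def)
  ultimately show thesis
    using that neg cont by simp
qed

section \<open>Causal bounded paths\<close>

lemma causal_bounded_continuous:
  assumes "w \<in> borel_measurable borel" "\<And>s. s < 0 \<Longrightarrow> w s = 0" "continuous_on {0..} w"
  shows "causal_bounded w"
  unfolding causal_bounded_def
proof (intro conjI allI impI assms)
  fix T
  have "compact (w ` {0..T})"
    by (intro compact_continuous_image continuous_on_subset[OF assms(3)]) auto
  then obtain m where m: "\<And>x. x \<in> w ` {0..T} \<Longrightarrow> \<bar>x\<bar> \<le> m"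
    using bounded_iff[of "w ` {0..T}"] compact_imp_bounded by auto
  have "\<bar>w s\<bar> \<le> max m 0" if "s \<le> T" for s
    using m[of "w s"] that assms(2)[of s] by (cases "s < 0") auto
  then show "\<exists>m\<ge>0. \<forall>s\<le>T. \<bar>w s\<bar> \<le> m"
    by (intro exI[of _ "max m 0"]) auto
qed

lemma causal_bounded_compose:
  assumes "causal_bounded w" and [measurable]: "h \<in> borel_measurable borel"
    and h: "\<And>x. \<bar>h x\<bar> \<le> C * \<bar>x\<bar>" and "0 \<le> C"
  shows "causal_bounded (\<lambda>s. h (w s))"
  unfolding causal_bounded_def
proof (intro conjI allI impI)
  have [measurable]: "w \<in> borel_measurable borel" using assms by (simp add: causal_bounded_def)
  show "(\<lambda>s. h (w s)) \<in> borel_measurable borel" by measurable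
  show "h (w s) = 0" if "s < 0" for s
    using assms(1) that h[of 0] by (simp add: causal_bounded_def)
  fix T
  obtain m where "0 \<le> m" "\<And>s. s \<le> T \<Longrightarrow> \<bar>w s\<bar> \<le> m"
    using assms(1) unfolding causal_bounded_def by blast
  then show "\<exists>m\<ge>0. \<forall>s\<le>T. \<bar>h (w s)\<bar> \<le> m"
    using \<open>0 \<le> C\<close> h by (intro exI[of _ "C * m"]) (auto intro: order_trans[OF h] mult_left_mono)
qed

lemma causal_bounded_cmult: "causal_bounded w \<Longrightarrow> causal_bounded (\<lambda>s. c * w s)"
  by (rule causal_bounded_compose[where C = "\<bar>c\<bar>"]) (auto simp: abs_mult)

theorem theorem4p6:
  fixes M :: "'a measure" and E :: "(real \<Rightarrow> 'a \<Rightarrow> real) set"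
    and f \<theta> :: "real \<Rightarrow> 'a \<Rightarrow> real"
    and h :: "real \<Rightarrow> real" and A C \<alpha> \<beta> \<gamma> \<tau> :: real
  assumes "prob_space M" and "complete_measure M"
    and "0 < \<beta>" and "\<beta> < 1" and "A < 0" and "1 < \<alpha>" and "\<alpha> < 2"
    and "0 < \<gamma>" and "\<gamma> < 1" and "\<alpha> + \<gamma> > 2" and "\<tau> + \<gamma> > 1"
    and "h \<in> borel_measurable borel"
    and "C > 0" and "A + C < 0" and "\<And>x. \<bar>h x\<bar> \<le> C * \<bar>x\<bar>"
    and "\<And>\<xi>. \<xi> \<in> E \<Longrightarrow> continuous_process M \<xi>"
    and "process M \<theta>"
    and "AE \<omega> in M. \<theta> 0 \<omega> = 0 \<and> (\<forall>T>0. holder_on \<gamma> {0..T} (\<lambda>t. \<theta> t \<omega>))"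
    and "process M f"
    and "AE \<omega> in M. C1_half_line (\<lambda>t. f t \<omega>) \<and> (\<forall>T>0. holder_on \<tau> {0..T} (\<lambda>t. f t \<omega>))"
    and mean_locally_integrable:
      "\<And>\<xi> Y T. \<lbrakk>\<xi> \<in> E; solves M \<beta> \<alpha> f \<theta> (\<lambda>x. A * x) \<xi> Y; T > 0\<rbrakk>
         \<Longrightarrow> (\<integral>\<^sup>+ t\<in>{0..T}. abs_mean M Y t \<partial>lborel) < \<infinity>"
    and "globally_stable_in_mean M E (solves M \<beta> \<alpha> f \<theta> (\<lambda>x. A * x))"
  shows "globally_stable_in_mean M E (solves M \<beta> \<alpha> f \<theta> (\<lambda>x. A * x + h x))"
  unfolding globally_stable_in_mean_def
proof (intro ballI allI impI)
  fix \<xi> X assume \<xi>: "\<xi> \<in> E" and X: "solves M \<beta> \<alpha> f \<theta> (\<lambda>x. A * x + h x) \<xi> X"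
  interpret prob_space M by fact
  interpret LM: pair_sigma_finite lborel M ..
  note b = \<open>0 < \<beta>\<close> \<open>\<beta> < 1\<close> and h = \<open>\<And>x. \<bar>h x\<bar> \<le> C * \<bar>x\<bar>\<close>
  note [measurable] = \<open>h \<in> borel_measurable borel\<close>
  \<comment> \<open>The linear equation has resolvent parameter \<open>- A = l + C\<close>.
    Absorbing the perturbation lowers it by \<open>C\<close>, and \<open>A + C < 0\<close> keeps
    what remains positive.\<close>
  define l where "l = - A - C"
  have l: "0 < l" "0 < l + C" and A: "A = - (l + C)"
    using \<open>A + C < 0\<close> \<open>C > 0\<close> by (auto simp: l_def)
  let ?g = "riesz \<beta>" and ?R = "resolvent \<beta> l" and ?K = "resolvent \<beta> (l + C)"
  note g = dominated_kernel_riesz[OF b(1)] and K = dominated_kernel_resolvent[OF b l(2)]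
  have Xc: "continuous_process M X" using X by (simp add: solves_def)
  \<comment> \<open>Joint measurability makes the convolution \<open>Z\<close> below measurable in
    \<omega>, and supplies measurable paths.\<close>
  obtain X' where X'm: "case_prod X' \<in> borel_measurable (lborel \<Otimes>\<^sub>M M)"
    and X'neg: "\<And>s \<omega>. s < 0 \<Longrightarrow> X' s \<omega> = 0"
    and X'cont: "\<And>\<omega>. continuous_on {0..} (\<lambda>s. X' s \<omega>)"
    and X'eq: "AE \<omega> in M. \<forall>s\<ge>0. X' s \<omega> = X s \<omega>"
    using continuous_process_modification[OF Xc] by blast
  note [measurable] = X'm
  have X'cb: "causal_bounded (\<lambda>s. X' s \<omega>)" if "\<omega> \<in> space M" for \<omega>
  proof (rule causal_bounded_continuous[OF _ X'neg X'cont])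
    have "(\<lambda>s. case_prod X' (s, \<omega>)) \<in> borel_measurable lborel"
      using that X'm by (intro measurable_compose[OF measurable_Pair2']) auto
    then show "(\<lambda>s. X' s \<omega>) \<in> borel_measurable borel" by simp
  qed

  \<comment> \<open>The associated solution of the linear equation\<close>
  define u where "u \<omega> s = h (X' s \<omega>)" for \<omega> s
  have ucb: "causal_bounded (u \<omega>)" if "\<omega> \<in> space M" for \<omega>
    unfolding u_def using \<open>C > 0\<close> by (intro causal_bounded_compose[OF X'cb[OF that] _ h]) auto
  define Z where "Z t \<omega> = rconv ?K (u \<omega>) t" for t \<omega>
  define Y where "Y t \<omega> = X t \<omega> - Z t \<omega>" for t \<omega>
  have Zm: "Z t \<in> borel_measurable M" for t
    unfolding Z_def[abs_def] rconv_def u_def by measurable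
  have Zcb: "causal_bounded (\<lambda>t. Z t \<omega>)" if "\<omega> \<in> space M" for \<omega>
    unfolding Z_def by (rule causal_bounded_rconv[OF b(1) K ucb[OF that]])
  have Yc: "continuous_process M Y"
    unfolding continuous_process_def process_def
  proof (intro conjI allI impI)
    fix t :: real assume "0 \<le> t"
    then have "X t \<in> borel_measurable M" using Xc by (simp add: continuous_process_def process_def)
    then show "Y t \<in> borel_measurable M" unfolding Y_def[abs_def] using Zm by (intro borel_measurable_diff)
  next
    have "AE \<omega> in M. continuous_on {0..} (\<lambda>t. X t \<omega>)" using Xc by (simp add: continuous_process_def)
    then show "AE \<omega> in M. continuous_on {0..} (\<lambda>t. Y t \<omega>)"
      using AE_space
    proof eventually_elim
      case (elim \<omega>)
      then show ?case unfolding Y_def Z_def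
        by (intro continuous_on_diff continuous_on_rconv_resolvent[OF b l(2)] ucb)
    qed
  qed
  have Ysol: "solves M \<beta> \<alpha> f \<theta> (\<lambda>x. A * x) \<xi> Y"
    unfolding solves_def
  proof (intro conjI Yc)
    have "AE \<omega> in M. \<forall>t\<ge>0. X t \<omega> = \<xi> t \<omega>
          + 1 / Gamma \<beta> * (LINT s:{0..t}|lborel. (t - s) powr (\<beta> - 1) * (A * X s \<omega> + h (X s \<omega>)))
          + 1 / Gamma \<alpha> * young_integral (\<lambda>s. (t - s) powr (\<alpha> - 1) * f s \<omega>) (\<lambda>s. \<theta> s \<omega>) 0 t"
      using X by (simp add: solves_def)
    then show "AE \<omega> in M. \<forall>t\<ge>0. Y t \<omega> = \<xi> t \<omega>
          + 1 / Gamma \<beta> * (LINT s:{0..t}|lborel. (t - s) powr (\<beta> - 1) * (A * Y s \<omega>))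
          + 1 / Gamma \<alpha> * young_integral (\<lambda>s. (t - s) powr (\<alpha> - 1) * f s \<omega>) (\<lambda>s. \<theta> s \<omega>) 0 t"
      using X'eq AE_space
    proof eventually_elim
      case (elim \<omega>)
      note cb = X'cb[OF elim(3)] and ucb = ucb[OF elim(3)] and Zcb = Zcb[OF elim(3)]
      show ?case
      proof (intro allI impI)
        fix t :: real assume t: "0 \<le> t"
        have h0: "h 0 = 0" using h[of 0] by simp
        have "1 / Gamma \<beta> * (LINT s:{0..t}|lborel. (t - s) powr (\<beta> - 1) * (A * X s \<omega> + h (X s \<omega>)))
            = rconv ?g (\<lambda>s. A * X' s \<omega> + u \<omega> s) t"
          using elim(2) by (intro fractional_integral_eq_rconv) (auto simp: u_def X'neg h0)
        also have "\<dots> = A * rconv ?g (\<lambda>s. X' s \<omega>) t + rconv ?g (u \<omega>) t"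
          by (simp add: rconv_add[OF b(1) g causal_bounded_cmult[OF cb] ucb] rconv_cmult)
        finally have 1: "1 / Gamma \<beta> * (LINT s:{0..t}|lborel. (t - s) powr (\<beta> - 1) * (A * X s \<omega> + h (X s \<omega>)))
            = A * rconv ?g (\<lambda>s. X' s \<omega>) t + rconv ?g (u \<omega>) t" .
        have "1 / Gamma \<beta> * (LINT s:{0..t}|lborel. (t - s) powr (\<beta> - 1) * (A * Y s \<omega>))
            = rconv ?g (\<lambda>s. A * (X' s \<omega> - Z s \<omega>)) t"
          using elim(2) Zcb by (intro fractional_integral_eq_rconv) (auto simp: Y_def X'neg causal_bounded_def)
        also have "\<dots> = A * rconv ?g (\<lambda>s. X' s \<omega>) t - A * rconv ?g (\<lambda>s. Z s \<omega>) t"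
          unfolding rconv_cmult rconv_diff[OF b(1) g cb Zcb] by (rule right_diff_distrib)
        finally have 2: "1 / Gamma \<beta> * (LINT s:{0..t}|lborel. (t - s) powr (\<beta> - 1) * (A * Y s \<omega>))
            = A * rconv ?g (\<lambda>s. X' s \<omega>) t - A * rconv ?g (\<lambda>s. Z s \<omega>) t" .
        \<comment> \<open>With parameter \<open>- A\<close>, the resolvent equation says that
          \<open>Z\<close> solves the linear Volterra equation driven by \<open>h(X)\<close>.
          Subtracting it from the equation of \<open>X\<close> removes \<open>h\<close> and leaves
          the datum and the Young integral untouched.\<close>
        have "Z t \<omega> = rconv ?g (u \<omega>) t + A * rconv ?g (\<lambda>s. Z s \<omega>) t"
          unfolding Z_def A by (subst rconv_resolvent[OF b l(2) ucb]) (simp add: algebra_simps)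
        moreover have "X t \<omega> = \<xi> t \<omega>
          + 1 / Gamma \<beta> * (LINT s:{0..t}|lborel. (t - s) powr (\<beta> - 1) * (A * X s \<omega> + h (X s \<omega>)))
          + 1 / Gamma \<alpha> * young_integral (\<lambda>s. (t - s) powr (\<alpha> - 1) * f s \<omega>) (\<lambda>s. \<theta> s \<omega>) 0 t"
          using elim(1) t by blast
        ultimately show "Y t \<omega> = \<xi> t \<omega>
          + 1 / Gamma \<beta> * (LINT s:{0..t}|lborel. (t - s) powr (\<beta> - 1) * (A * Y s \<omega>))
          + 1 / Gamma \<alpha> * young_integral (\<lambda>s. (t - s) powr (\<alpha> - 1) * f s \<omega>) (\<lambda>s. \<theta> s \<omega>) 0 t"
          unfolding 1 2 by (simp add: Y_def)
      qed
    qed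
  qed

  \<comment> \<open>Comparison along paths and in the mean\<close>
  obtain Y' where Y'm: "case_prod Y' \<in> borel_measurable (lborel \<Otimes>\<^sub>M M)"
    and Y'neg: "\<And>s \<omega>. s < 0 \<Longrightarrow> Y' s \<omega> = 0"
    and Y'cont: "\<And>\<omega>. continuous_on {0..} (\<lambda>s. Y' s \<omega>)"
    and Y'eq: "AE \<omega> in M. \<forall>s\<ge>0. Y' s \<omega> = Y s \<omega>"
    using continuous_process_modification[OF Yc] by blast
  note [measurable] = Y'm
  define y where "y s = (\<integral>\<^sup>+ \<omega>. ennreal \<bar>Y' s \<omega>\<bar> \<partial>M)" for s
  have ym [measurable]: "y \<in> borel_measurable borel"
  proof -
    have "y \<in> borel_measurable lborel" unfolding y_def[abs_def] by measurable
    then show ?thesis by simp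
  qed
  have y_eq: "y s = abs_mean M Y s" if "0 \<le> s" for s
    unfolding y_def abs_mean_def using Y'eq that by (intro nn_integral_cong_AE) (auto elim!: eventually_mono)
  \<comment> \<open>The comparison is made before taking expectations: continuity of a path gives
    the finite local bound that the cancellation requires, whereas no local bound on the mean of
    \<open>X\<close> is known in advance.\<close>
  have path: "AE \<omega> in M. ennreal \<bar>X t \<omega>\<bar> \<le> ennreal \<bar>Y' t \<omega>\<bar>
      + ennreal C * nconv (\<lambda>s. ennreal (?R s)) (\<lambda>s. ennreal \<bar>Y' s \<omega>\<bar>) t" if t: "0 \<le> t" for t
    using X'eq Y'eq AE_space
  proof eventually_elim
    case (elim \<omega>)
    note cb = X'cb[OF elim(3)] and ucb = ucb[OF elim(3)]
    have [measurable]: "(\<lambda>s. X' s \<omega>) \<in> borel_measurable borel" using cb by (simp add: causal_bounded_def)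
    have [measurable]: "(\<lambda>s. Y' s \<omega>) \<in> borel_measurable borel"
    proof -
      have "(\<lambda>s. case_prod Y' (s, \<omega>)) \<in> borel_measurable lborel"
        using elim(3) Y'm by (intro measurable_compose[OF measurable_Pair2']) auto
      then show ?thesis by simp
    qed
    obtain m where m: "\<And>s. s \<le> t \<Longrightarrow> \<bar>X' s \<omega>\<bar> \<le> m"
      using cb unfolding causal_bounded_def by blast
    have "ennreal \<bar>X' t \<omega>\<bar> \<le> ennreal \<bar>Y' t \<omega>\<bar>
        + ennreal C * nconv (\<lambda>s. ennreal (?R s)) (\<lambda>s. ennreal \<bar>Y' s \<omega>\<bar>) t"
    proof (rule volterra_comparison[OF b l(1) \<open>C > 0\<close>])
      fix s
      show "ennreal \<bar>X' s \<omega>\<bar> \<le> ennreal \<bar>Y' s \<omega>\<bar>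
        + ennreal C * nconv (\<lambda>s. ennreal (?K s)) (\<lambda>s. ennreal \<bar>X' s \<omega>\<bar>) s"
      proof (cases "0 \<le> s")
        case True
        have "ennreal \<bar>Z s \<omega>\<bar> \<le> (\<integral>\<^sup>+ r. ennreal (norm (?K (s - r) * u \<omega> r)) \<partial>lborel)"
          unfolding Z_def rconv_def real_norm_def[symmetric]
          by (intro integral_norm_bound_ennreal integrable_rconv[OF b(1) K ucb])
        also have "\<dots> \<le> (\<integral>\<^sup>+ r. ennreal C * (ennreal (?K (s - r)) * ennreal \<bar>X' r \<omega>\<bar>) \<partial>lborel)"
        proof (intro nn_integral_mono)
          fix r
          have "norm (?K (s - r) * u \<omega> r) \<le> ?K (s - r) * (C * \<bar>X' r \<omega>\<bar>)"
            using resolvent_nonneg[OF b l(2), of "s - r"] h[of "X' r \<omega>"]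
            by (simp add: abs_mult u_def mult_left_mono)
          then have "ennreal (norm (?K (s - r) * u \<omega> r)) \<le> ennreal (?K (s - r) * (C * \<bar>X' r \<omega>\<bar>))"
            by (rule ennreal_leI)
          also have "\<dots> = ennreal C * (ennreal (?K (s - r)) * ennreal \<bar>X' r \<omega>\<bar>)"
            using resolvent_nonneg[OF b l(2), of "s - r"] \<open>C > 0\<close> by (simp add: ennreal_mult mult_ac)
          finally show "ennreal (norm (?K (s - r) * u \<omega> r)) \<le> \<dots>" .
        qed
        also have "\<dots> = ennreal C * nconv (\<lambda>s. ennreal (?K s)) (\<lambda>s. ennreal \<bar>X' s \<omega>\<bar>) s"
          unfolding nconv_def by (subst nn_integral_cmult) auto
        finally have Zb: "ennreal \<bar>Z s \<omega>\<bar> \<le> ennreal C * nconv (\<lambda>s. ennreal (?K s)) (\<lambda>s. ennreal \<bar>X' s \<omega>\<bar>) s" .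
        have "X' s \<omega> = Y' s \<omega> + Z s \<omega>" using elim True by (simp add: Y_def)
        then have "ennreal \<bar>X' s \<omega>\<bar> \<le> ennreal (\<bar>Y' s \<omega>\<bar> + \<bar>Z s \<omega>\<bar>)" by (intro ennreal_leI) simp
        also have "\<dots> = ennreal \<bar>Y' s \<omega>\<bar> + ennreal \<bar>Z s \<omega>\<bar>" by simp
        also have "\<dots> \<le> ennreal \<bar>Y' s \<omega>\<bar>
            + ennreal C * nconv (\<lambda>s. ennreal (?K s)) (\<lambda>s. ennreal \<bar>X' s \<omega>\<bar>) s"
          by (intro add_left_mono Zb)
        finally show ?thesis .
      qed (simp add: X'neg)
    qed (use m in \<open>auto simp: X'neg intro: ennreal_leI\<close>)
    then show ?case using elim t by simp
  qed
  have mean: "abs_mean M X t \<le> y t + ennreal C * nconv (\<lambda>s. ennreal (?R s)) y t" if t: "0 \<le> t" for t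
  proof -
    have Y't [measurable]: "Y' t \<in> borel_measurable M"
      using measurable_compose[OF measurable_Pair1' Y'm, of t] by simp
    have "abs_mean M X t \<le> (\<integral>\<^sup>+ \<omega>. ennreal \<bar>Y' t \<omega>\<bar>
        + ennreal C * nconv (\<lambda>s. ennreal (?R s)) (\<lambda>s. ennreal \<bar>Y' s \<omega>\<bar>) t \<partial>M)"
      unfolding abs_mean_def by (intro nn_integral_mono_AE path t)
    also have "\<dots> = y t + ennreal C * (\<integral>\<^sup>+ \<omega>. nconv (\<lambda>s. ennreal (?R s)) (\<lambda>s. ennreal \<bar>Y' s \<omega>\<bar>) t \<partial>M)"
      unfolding nconv_def y_def by (simp add: nn_integral_add nn_integral_cmult)
    \<comment> \<open>Tonelli; this is where the joint measurability of \<open>Y'\<close>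
      enters.\<close>
    also have "(\<integral>\<^sup>+ \<omega>. nconv (\<lambda>s. ennreal (?R s)) (\<lambda>s. ennreal \<bar>Y' s \<omega>\<bar>) t \<partial>M)
        = (\<integral>\<^sup>+ s. (\<integral>\<^sup>+ \<omega>. ennreal (?R (t - s)) * ennreal \<bar>Y' s \<omega>\<bar> \<partial>M) \<partial>lborel)"
      unfolding nconv_def by (rule LM.Fubini') measurable
    also have "\<dots> = nconv (\<lambda>s. ennreal (?R s)) y t"
      unfolding nconv_def y_def
    proof (intro nn_integral_cong nn_integral_cmult)
      fix s :: real
      have [measurable]: "Y' s \<in> borel_measurable M"
        using measurable_compose[OF measurable_Pair1' Y'm, of s] by simp
      show "(\<lambda>\<omega>. ennreal \<bar>Y' s \<omega>\<bar>) \<in> borel_measurable M" by measurable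
    qed
    finally show ?thesis .
  qed

  \<comment> \<open>Passage to the limit\<close>
  have "(abs_mean M Y \<longlongrightarrow> 0) at_top"
    using \<open>globally_stable_in_mean M E (solves M \<beta> \<alpha> f \<theta> (\<lambda>x. A * x))\<close> \<xi> Ysol
    by (simp add: globally_stable_in_mean_def)
  moreover have "eventually (\<lambda>s. abs_mean M Y s = y s) at_top"
    using eventually_ge_at_top[of 0] by eventually_elim (simp add: y_eq)
  ultimately have ylim: "(y \<longlongrightarrow> 0) at_top"
    using Lim_transform_eventually by blast
  \<comment> \<open>Stability controls \<open>y\<close> only for large times; on bounded intervals
    \<open>mean_locally_integrable\<close> provides the finite integral needed by the splitting
    argument.\<close>
  have "(nconv (\<lambda>s. ennreal (?R s)) y \<longlongrightarrow> 0) at_top"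
  proof (rule nconv_resolvent_tendsto_0[OF b l(1) ym _ _ ylim])
    show "y s = 0" if "s < 0" for s using that by (simp add: y_def Y'neg)
    fix T :: real assume "0 < T"
    have "(\<integral>\<^sup>+ s\<in>{0..T}. y s \<partial>lborel) = (\<integral>\<^sup>+ s\<in>{0..T}. abs_mean M Y s \<partial>lborel)"
      by (intro nn_integral_cong) (auto simp: y_eq split: split_indicator)
    also have "\<dots> < \<infinity>" by (rule mean_locally_integrable[OF \<xi> Ysol \<open>0 < T\<close>])
    finally show "(\<integral>\<^sup>+ s\<in>{0..T}. y s \<partial>lborel) < \<infinity>" .
  qed
  then have lim: "((\<lambda>t. y t + ennreal C * nconv (\<lambda>s. ennreal (?R s)) y t) \<longlongrightarrow> 0 + ennreal C * 0) at_top"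
    by (intro tendsto_add ylim ennreal_tendsto_cmult) auto
  show "(abs_mean M X \<longlongrightarrow> 0) at_top"
  proof (rule tendsto_sandwich[OF _ _ tendsto_const])
    show "eventually (\<lambda>t. abs_mean M X t \<le> y t + ennreal C * nconv (\<lambda>s. ennreal (?R s)) y t) at_top"
      using eventually_ge_at_top[of 0] by eventually_elim (rule mean)
    show "((\<lambda>t. y t + ennreal C * nconv (\<lambda>s. ennreal (?R s)) y t) \<longlongrightarrow> 0) at_top"
      using lim by simp
  qed simp
qed

end
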